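(* Let $p=1$, $A=\mathbb{R}_+$ and $\pi_{U,A}(\theta)=\mathbb{I}_A(\theta_1-\theta_2)$. The Bayes predictive density estimator $\hat q_{\pi_{U,A}}(\cdot;x)$ of the density of $Y_1$ under $\alpha$-divergence loss, with $n=\frac{2}{1-\alpha}$ a positive integer, is given by a $\mathrm{SN}(n,\alpha_0,\alpha_1,\xi,\tau)$ density with $$\alpha_0=\frac{x_1-x_2}{\sigma_T},\quad \alpha_1=\frac{\beta\tau}{\sigma_T},\quad \xi=x_1,\quad \tau=\sqrt{\frac{\sigma_1^2}{n}+\sigma_Y^2},$$ where $\sigma_T^2=\sigma_2^2+n\beta\sigma_Y^2$ and $\beta=\frac{\sigma_1^2}{\sigma_1^2+n\sigma_Y^2}$.
   Context: Model: $X=(X_1,X_2)$ and $Y_1$, with $X_1\sim N(\theta_1,\sigma_1^2)$, $X_2\sim N(\theta_2,\sigma_2^2)$, $Y_1\sim N(\theta_1,\sigma_Y^2)$ independent, where $\sigma_1^2,\sigma_2^2,\sigma_Y^2>0$ are known and $\theta_1-\theta_2\in A$. Let $q_{\theta_1}$ be the density of $Y_1$. $\alpha$-divergence loss: $L_\alpha(\theta,\hat q)=\int_{\mathbb{R}}h_\alpha\!\left(\frac{\hat q(y;x)}{q_{\theta_1}(y)}\right)q_{\theta_1}(y)\,dy$, where $h_\alpha(z)=\frac{4}{1-\alpha^2}(1-z^{(1+\alpha)/2})$ for $|\alpha|<1$ and $h_{-1}(z)=-\log z$. The Bayes predictive density is the density $\hat q(\cdot;x)$ minimizing the posterior expected loss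 given $X=x=(x_1,x_2)$. $\mathrm{SN}(n,\alpha_0,\alpha_1,\xi,\tau)$, with $n$ a positive integer, $\alpha_0,\alpha_1,\xi\in\mathbb{R}$, $\tau>0$, denotes the generalized Balakrishnan type skewed-normal distribution with density on $\mathbb{R}$ $$\frac{1}{K_n(\alpha_0,\alpha_1)}\,\frac1\tau\,\phi\!\left(\frac{t-\xi}{\tau}\right)\Phi^n\!\left(\alpha_0+\alpha_1\frac{t-\xi}{\tau}\right),\qquad K_n(\alpha_0,\alpha_1)=\Phi_n\!\left(\frac{\alpha_0}{\sqrt{1+\alpha_1^2}},\ldots,\frac{\alpha_0}{\sqrt{1+\alpha_1^2}};\ \rho=\frac{\alpha_1^2}{1+\alpha_1^2}\right),$$ where $\phi,\Phi$ are the $N(0,1)$ density and c.d.f., and $\Phi_n(\cdot;\rho)$ is the c.d.f. of the $N_n(0,\Lambda)$ distribution with $\Lambda=(1-\rho)I_n+\rho\,1_n1_n'$. *)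

theory Defs
  imports
    "HOL-Probability.Probability"
    "Jordan_Normal_Form.Gauss_Jordan_Elimination"
    "Jordan_Normal_Form.Determinant"
begin

section \<open>Multivariate normal distribution in a numerically given dimension\<close>

text \<open>Matrices and vectors are those of the AFP entry Jordan-Normal-Form, because the dimension
  \<open>n\<close> is a number. Names that also exist in HOL-Analysis are qualified. Points of \<open>R^n\<close> are the
  extensional functions on \<open>{..<n}\<close>. For a singular \<open>\<Lambda>\<close> the definitions below
  carry no meaning.\<close>

definition mvn_density :: "nat \<Rightarrow> real Matrix.mat \<Rightarrow> (nat \<Rightarrow> real) \<Rightarrow> real" where
  "mvn_density n \<Lambda> z =
     exp (- (1/2) * Matrix.scalar_prod (Matrix.vec n z)
                      (Matrix.mult_mat_vec (the (mat_inverse \<Lambda>)) (Matrix.vec n z)))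
     / sqrt ((2 * pi) ^ n * Determinant.det \<Lambda>)"

definition mvn :: "nat \<Rightarrow> real Matrix.mat \<Rightarrow> (nat \<Rightarrow> real) measure" where
  "mvn n \<Lambda> = density (\<Pi>\<^sub>M i\<in>{..<n}. lborel) (\<lambda>z. ennreal (mvn_density n \<Lambda> z))"

definition equicorr_mat :: "nat \<Rightarrow> real \<Rightarrow> real Matrix.mat" where
  "equicorr_mat n \<rho> =
     (1 - \<rho>) \<cdot>\<^sub>m 1\<^sub>m n + \<rho> \<cdot>\<^sub>m Matrix.mat n n (\<lambda>_. 1)"

definition std_normal_cdf :: "real \<Rightarrow> real" where
  "std_normal_cdf = cdf std_normal_distribution"

definition equicorr_normal_cdf :: "nat \<Rightarrow> (nat \<Rightarrow> real) \<Rightarrow> real \<Rightarrow> real" where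
  "equicorr_normal_cdf n a \<rho> =
     measure (mvn n (equicorr_mat n \<rho>))
       {z \<in> space (mvn n (equicorr_mat n \<rho>)). \<forall>i<n. z i \<le> a i}"


section \<open>Generalized Balakrishnan type skewed-normal densities\<close>

definition SN_const :: "nat \<Rightarrow> real \<Rightarrow> real \<Rightarrow> real" where
  "SN_const n \<alpha>0 \<alpha>1 =
     equicorr_normal_cdf n (\<lambda>_. \<alpha>0 / sqrt (1 + \<alpha>1\<^sup>2)) (\<alpha>1\<^sup>2 / (1 + \<alpha>1\<^sup>2))"

definition SN_density :: "nat \<Rightarrow> real \<Rightarrow> real \<Rightarrow> real \<Rightarrow> real \<Rightarrow> real \<Rightarrow> real" where
  "SN_density n \<alpha>0 \<alpha>1 \<xi> \<tau> t =
     1 / SN_const n \<alpha>0 \<alpha>1 * (1 / \<tau>) * std_normal_density ((t - \<xi>) / \<tau>)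
       * std_normal_cdf (\<alpha>0 + \<alpha>1 * ((t - \<xi>) / \<tau>)) ^ n"


section \<open>Bayes predictive densities under alpha-divergence loss\<close>

definition is_density :: "(real \<Rightarrow> real) \<Rightarrow> bool" where
  "is_density f \<longleftrightarrow>
     f \<in> borel_measurable borel \<and> (\<forall>y. 0 \<le> f y) \<and> (\<integral>\<^sup>+y. ennreal (f y) \<partial>lborel) = 1"

text \<open>Losses may be infinite (Kullback-Leibler case), whereas the Bochner integral is \<open>0\<close> on
  non-integrable functions; hence the integral as positive part minus negative part. In all uses
  below, on densities, the negative part has finite integral.\<close>

definition ext_integral :: "'a measure \<Rightarrow> ('a \<Rightarrow> ereal) \<Rightarrow> ereal" where
  "ext_integral M f =
     enn2ereal (\<integral>\<^sup>+x. e2ennreal (f x) \<partial>M) - enn2ereal (\<integral>\<^sup>+x. e2ennreal (- f x) \<partial>M)"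

text \<open>\<open>- log 0\<close> has to be infinite, whereas \<open>ln 0 = 0\<close> in the library.\<close>

definition h_alpha :: "real \<Rightarrow> real \<Rightarrow> ereal" where
  "h_alpha \<alpha> z =
     (if \<alpha> = -1 then (if z = 0 then \<infinity> else ereal (- ln z))
      else ereal (4 / (1 - \<alpha>\<^sup>2) * (1 - z powr ((1 + \<alpha>) / 2))))"

text \<open>Throughout, \<open>\<sigma>1\<close>, \<open>\<sigma>2\<close> and \<open>\<sigma>Y\<close> are standard deviations, as in
  \<^const>\<open>normal_density\<close>, and pairs are \<open>\<theta> = (\<theta>1, \<theta>2)\<close> and \<open>x = (x1, x2)\<close>.\<close>

definition alpha_loss :: "real \<Rightarrow> real \<Rightarrow> real \<times> real \<Rightarrow> (real \<Rightarrow> real) \<Rightarrow> ereal" where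
  "alpha_loss \<alpha> \<sigma>Y \<theta> q =
     ext_integral lborel
       (\<lambda>y. h_alpha \<alpha> (q y / normal_density (fst \<theta>) \<sigma>Y y) * ereal (normal_density (fst \<theta>) \<sigma>Y y))"

definition uniform_prior :: "real set \<Rightarrow> real \<times> real \<Rightarrow> real" where
  "uniform_prior A \<theta> = indicator A (fst \<theta> - snd \<theta>)"

definition likelihood :: "real \<Rightarrow> real \<Rightarrow> real \<times> real \<Rightarrow> real \<times> real \<Rightarrow> real" where
  "likelihood \<sigma>1 \<sigma>2 \<theta> x =
     normal_density (fst \<theta>) \<sigma>1 (fst x) * normal_density (snd \<theta>) \<sigma>2 (snd x)"

text \<open>\<open>\<pi>\<close> is a possibly improper prior density with respect to Lebesgue measure on the plane.\<close>

definition posterior ::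
  "real \<Rightarrow> real \<Rightarrow> (real \<times> real \<Rightarrow> real) \<Rightarrow> real \<times> real \<Rightarrow> (real \<times> real) measure" where
  "posterior \<sigma>1 \<sigma>2 \<pi> x =
     density lborel (\<lambda>\<theta>. ennreal (likelihood \<sigma>1 \<sigma>2 \<theta> x * \<pi> \<theta>)
       / (\<integral>\<^sup>+\<eta>. ennreal (likelihood \<sigma>1 \<sigma>2 \<eta> x * \<pi> \<eta>) \<partial>lborel))"

definition posterior_expected_loss ::
  "real \<Rightarrow> real \<Rightarrow> real \<Rightarrow> real \<Rightarrow> (real \<times> real \<Rightarrow> real) \<Rightarrow> real \<times> real \<Rightarrow> (real \<Rightarrow> real) \<Rightarrow> ereal"
where
  "posterior_expected_loss \<alpha> \<sigma>1 \<sigma>2 \<sigma>Y \<pi> x q =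
     ext_integral (posterior \<sigma>1 \<sigma>2 \<pi> x) (\<lambda>\<theta>. alpha_loss \<alpha> \<sigma>Y \<theta> q)"

definition is_bayes_predictive_density ::
  "real \<Rightarrow> real \<Rightarrow> real \<Rightarrow> real \<Rightarrow> (real \<times> real \<Rightarrow> real) \<Rightarrow> real \<times> real \<Rightarrow> (real \<Rightarrow> real) \<Rightarrow> bool"
where
  "is_bayes_predictive_density \<alpha> \<sigma>1 \<sigma>2 \<sigma>Y \<pi> x q \<longleftrightarrow>
     is_density q \<and>
     (\<forall>r. is_density r \<longrightarrow>
        posterior_expected_loss \<alpha> \<sigma>1 \<sigma>2 \<sigma>Y \<pi> x q \<le> posterior_expected_loss \<alpha> \<sigma>1 \<sigma>2 \<sigma>Y \<pi> x r)"

end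

theory Submission
  imports Defs
begin

text \<open>Write \<open>\<nu> = 2 / (1 - \<alpha>)\<close> and let \<open>f\<close> be the density of \<open>Y1\<close>, random under the posterior. For
  \<open>\<alpha> > -1\<close> the posterior expected loss of \<open>q\<close> depends on \<open>q\<close> only through
  \<open>- \<integral> q powr ((1 + \<alpha>) / 2) * E (f powr (1 / \<nu>))\<close>, and for \<open>\<alpha> = -1\<close> through \<open>- \<integral> ln q * E f\<close>;
  in both cases the minimizer is the normalized \<open>\<nu>\<close>-th power of \<open>y \<mapsto> E (f y powr (1 / \<nu>))\<close>.

  To treat both cases at once, and to cope with infinite losses, \<open>\<nu> * (q - f)\<close> is added to the
  integrand of the loss. It integrates to \<open>0\<close>, so that the loss is unchanged, but by convexity of
  \<open>h_alpha \<alpha>\<close> the new integrand, the divergence gap of \<open>f\<close> and \<open>q\<close>, is nonnegative and vanishes only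
  for \<open>q = f\<close>. Everything then takes place in the extended nonnegative reals, where Tonelli's theorem
  applies freely. If \<open>E (f powr (1 / \<nu>)) = \<kappa> * s powr (1 / \<nu>)\<close> for a positive density \<open>s\<close>, then
  \<^const>\<open>h_alpha\<close> being a power or a logarithm yields the compensation identity
  (\<open>expected_gap_compensation\<close>): the risk of \<open>q\<close> is the risk of \<open>s\<close> plus \<open>\<kappa>\<close> times the integrated
  gap of \<open>s\<close> and \<open>q\<close>. As soon as a single density has finite risk, \<open>s\<close> is the minimizer, and it is
  unique up to null sets. A normal density centred at \<open>x1\<close> has finite risk, since its
  Kullback-Leibler loss is quadratic in \<open>\<theta>1\<close>.

  It remains to identify \<open>s\<close>. The \<open>n\<close>-th root of a normal density is a multiple of a normal density
  with \<open>n\<close> times the variance; multiplied by the density of \<open>\<theta>1\<close> it factors into a normal density in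
  \<open>y\<close> and one in \<open>\<theta>1\<close>. The constraint \<open>\<theta>2 \<le> \<theta>1\<close> contributes \<open>\<Phi> ((\<theta>1 - x2) / \<sigma>2)\<close>, and averaging
  this over a normal \<open>\<theta>1\<close> gives again a value of \<open>\<Phi>\<close> (\<open>powr_mean_posterior_half_plane\<close>). The \<open>n\<close>-th
  power of the result is the skew-normal density up to its constant. That
  \<open>K_n (\<alpha>0, \<alpha>1) = \<integral> \<phi> u * \<Phi> (\<alpha>0 + \<alpha>1 * u) ^ n du\<close> is the right constant (\<open>SN_const_eq_nn_integral\<close>)
  holds because standard normals minus a common factor \<open>\<alpha>1 * U\<close>, rescaled, form an equicorrelated
  normal vector.\<close>

section \<open>The integrand of the alpha-divergence loss\<close>

text \<open>With \<open>m = 1 + g * (z - 1)\<close>, the weighted mean of \<open>z\<close> and \<open>1\<close>, add the inequalities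
  \<open>ln w \<le> w - 1\<close> at \<open>w = z / m\<close> and \<open>w = 1 / m\<close> with weights \<open>g\<close> and \<open>1 - g\<close>: the right-hand sides cancel.
  Equality forces \<open>1 / m = 1\<close>.\<close>

lemma powr_tangent_at_1:
  fixes g z :: real
  assumes g: "0 < g" "g < 1" and z: "0 \<le> z"
  shows powr_le_tangent_at_1: "z powr g \<le> 1 + g * (z - 1)"
    and powr_eq_tangent_at_1_imp: "z powr g = 1 + g * (z - 1) \<Longrightarrow> z = 1"
proof -
  define m where "m = 1 + g * (z - 1)"
  have m: "m > 0"
  proof -
    have "m = (1 - g) + g * z" by (simp add: m_def algebra_simps)
    moreover have "g * z \<ge> 0" using g z by simp
    ultimately show ?thesis using g by linarith
  qed
  have sum0: "g * (z / m - 1) + (1 - g) * (1 / m - 1) = 0"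
    using m by (simp add: field_simps) (simp add: m_def algebra_simps)
  have main: "g * ln z \<le> ln m \<and> (g * ln z = ln m \<longrightarrow> z = 1)" if "z > 0"
  proof -
    have e: "g * ln z - ln m = g * ln (z / m) + (1 - g) * ln (1 / m)"
      using that m by (simp add: ln_div algebra_simps)
    have a: "g * ln (z / m) \<le> g * (z / m - 1)"
      using that m g by (intro mult_left_mono ln_le_minus_one) auto
    have b: "(1 - g) * ln (1 / m) \<le> (1 - g) * (1 / m - 1)"
      using that m g by (intro mult_left_mono ln_le_minus_one) auto
    have "z = 1" if eq: "g * ln z = ln m"
    proof -
      have "(1 - g) * ln (1 / m) = (1 - g) * (1 / m - 1)"
        using a b e sum0 eq by linarith
      then have "ln (1 / m) = 1 / m - 1" using g by simp
      then have "1 / m = 1" using m by (intro ln_eq_minus_one) auto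
      then have "g * (z - 1) = 0" using m by (simp add: m_def)
      then show ?thesis using g by simp
    qed
    then show ?thesis using a b e sum0 by linarith
  qed
  show "z powr g \<le> 1 + g * (z - 1)"
  proof (cases "z = 0")
    case False
    then have "exp (g * ln z) \<le> m" using main z m
      by (metis antisym_conv3 exp_ln exp_le_cancel_iff not_less)
    then show ?thesis using False z by (simp add: powr_def m_def)
  qed (use g in simp)
  show "z = 1" if eq: "z powr g = 1 + g * (z - 1)"
  proof (cases "z = 0")
    case False
    then have "g * ln z = ln m" using eq z by (metis m_def ln_powr)
    then show ?thesis using main False z by simp
  qed (use eq g in simp)
qed

text \<open>The real-valued part of \<^const>\<open>h_alpha\<close>. Only for \<open>\<alpha> = -1\<close> and \<open>z = 0\<close>, where \<open>ln 0 = 0\<close> makes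
  it \<open>0\<close>, does it differ from the true value.\<close>

definition h_alpha_fin :: "real \<Rightarrow> real \<Rightarrow> real" where
  "h_alpha_fin \<alpha> z =
     (if \<alpha> = -1 then - ln z else 4 / (1 - \<alpha>\<^sup>2) * (1 - z powr ((1 + \<alpha>) / 2)))"

lemma h_alpha_eq:
  "h_alpha \<alpha> z = (if \<alpha> = -1 \<and> z = 0 then \<infinity> else ereal (h_alpha_fin \<alpha> z))"
  by (simp add: h_alpha_def h_alpha_fin_def)

lemma borel_measurable_h_alpha [measurable]: "h_alpha \<alpha> \<in> borel_measurable borel"
  unfolding h_alpha_def[abs_def] by measurable

lemma h_alpha_fin_1 [simp]: "h_alpha_fin \<alpha> 1 = 0"
  by (simp add: h_alpha_fin_def)

lemma alpha_factor_eqs: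
  fixes \<alpha> :: real
  assumes "-1 < \<alpha>" "\<alpha> < 1"
  shows "4 / (1 - \<alpha>\<^sup>2) > 0" "4 / (1 - \<alpha>\<^sup>2) * ((1 + \<alpha>) / 2) = 2 / (1 - \<alpha>)"
proof -
  have e: "1 - \<alpha>\<^sup>2 = (1 - \<alpha>) * (1 + \<alpha>)" by (simp add: power2_eq_square algebra_simps)
  show "4 / (1 - \<alpha>\<^sup>2) > 0" unfolding e using assms by simp
  show "4 / (1 - \<alpha>\<^sup>2) * ((1 + \<alpha>) / 2) = 2 / (1 - \<alpha>)"
    unfolding e using assms by (simp add: divide_simps)
qed

text \<open>The slope of \<open>h_alpha \<alpha>\<close> at \<open>1\<close> is \<open>- 2 / (1 - \<alpha>)\<close> in the power case and in the logarithmic case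
  alike. This is what allows the two to be treated together.\<close>

lemma h_alpha_fin_above_tangent:
  assumes \<alpha>: "-1 \<le> \<alpha>" "\<alpha> < 1" and z: "0 \<le> z" "\<not> (\<alpha> = -1 \<and> z = 0)"
  shows h_alpha_fin_tangent_nonneg: "0 \<le> h_alpha_fin \<alpha> z + 2 / (1 - \<alpha>) * (z - 1)"
    and h_alpha_fin_tangent_eq_0: "h_alpha_fin \<alpha> z + 2 / (1 - \<alpha>) * (z - 1) = 0 \<Longrightarrow> z = 1"
proof -
  have "0 \<le> h_alpha_fin \<alpha> z + 2 / (1 - \<alpha>) * (z - 1) \<and>
    (h_alpha_fin \<alpha> z + 2 / (1 - \<alpha>) * (z - 1) = 0 \<longrightarrow> z = 1)"
  proof (cases "\<alpha> = -1")
    case True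
    then show ?thesis using z ln_le_minus_one[of z] ln_eq_minus_one[of z]
      by (auto simp: h_alpha_fin_def)
  next
    case False
    define g where "g = (1 + \<alpha>) / 2"
    define c where "c = 4 / (1 - \<alpha>\<^sup>2)"
    have g: "0 < g" "g < 1" using \<alpha> False by (auto simp: g_def)
    have c: "c > 0" "c * g = 2 / (1 - \<alpha>)"
      using alpha_factor_eqs[of \<alpha>] \<alpha> False by (auto simp: c_def g_def)
    have "h_alpha_fin \<alpha> z + 2 / (1 - \<alpha>) * (z - 1) = c * (1 + g * (z - 1) - z powr g)"
      using False by (simp add: h_alpha_fin_def c(2)[symmetric] flip: c_def g_def)
        (simp add: algebra_simps)
    then show ?thesis
      using c powr_le_tangent_at_1[OF g z(1)] powr_eq_tangent_at_1_imp[OF g z(1)] by auto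
  qed
  then show "0 \<le> h_alpha_fin \<alpha> z + 2 / (1 - \<alpha>) * (z - 1)"
    and "h_alpha_fin \<alpha> z + 2 / (1 - \<alpha>) * (z - 1) = 0 \<Longrightarrow> z = 1" by auto
qed

text \<open>All the losses are dominated by a multiple of the Kullback-Leibler loss, so that only the latter
  has to be bounded.\<close>

lemma h_alpha_fin_le_ln:
  assumes \<alpha>: "-1 \<le> \<alpha>" "\<alpha> < 1" and z: "0 < z"
  shows "h_alpha_fin \<alpha> z \<le> 2 / (1 - \<alpha>) * - ln z"
proof (cases "\<alpha> = -1")
  case False
  define g where "g = (1 + \<alpha>) / 2"
  define c where "c = 4 / (1 - \<alpha>\<^sup>2)"
  have c: "c > 0" "c * g = 2 / (1 - \<alpha>)"
    using alpha_factor_eqs[of \<alpha>] \<alpha> False by (auto simp: c_def g_def)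
  have "1 + g * ln z \<le> z powr g"
    using exp_ge_add_one_self[of "g * ln z"] z by (simp add: powr_def)
  then have "c * (1 - z powr g) \<le> c * (g * - ln z)"
    using c by (intro mult_left_mono) auto
  then show ?thesis
    using False by (simp add: h_alpha_fin_def c(2)[symmetric] flip: c_def g_def)
qed (simp add: h_alpha_fin_def)

text \<open>Replacing the candidate \<open>s\<close> by \<open>q\<close> changes the integrand of the loss by a quantity that depends on
  \<open>f\<close> only through the factor \<open>f powr ((1 - \<alpha>) / 2)\<close>. Hence only the posterior mean of this power
  matters.\<close>

lemma h_alpha_fin_change_reference:
  assumes pos: "0 < f" "0 < s" and q: "0 \<le> q" "\<not> (\<alpha> = -1 \<and> q = 0)"
  shows "h_alpha_fin \<alpha> (q / f) * f =
    h_alpha_fin \<alpha> (s / f) * f + (f / s) powr ((1 - \<alpha>) / 2) * (h_alpha_fin \<alpha> (q / s) * s)"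
proof (cases "\<alpha> = -1")
  case True
  then show ?thesis using pos q by (simp add: h_alpha_fin_def ln_div algebra_simps)
next
  case False
  define g where "g = (1 + \<alpha>) / 2"
  define c where "c = 4 / (1 - \<alpha>\<^sup>2)"
  have w: "(f / s) powr ((1 - \<alpha>) / 2) = (f / f powr g) / (s / s powr g)"
  proof -
    have "(1 - \<alpha>) / 2 = 1 - g" by (simp add: g_def field_simps)
    show ?thesis unfolding \<open>(1 - \<alpha>) / 2 = 1 - g\<close> using pos by (simp add: powr_diff powr_divide)
  qed
  have F: "f powr g > 0" "s powr g > 0" using pos by auto
  show ?thesis
    using False pos q F unfolding w
    by (simp add: h_alpha_fin_def powr_divide flip: g_def c_def) (simp add: field_simps)
qed

text \<open>The integrand of the loss, made nonnegative by the subtraction of the tangent of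
  \<open>h_alpha \<alpha>\<close> at \<open>1\<close>.\<close>

definition divergence_gap :: "real \<Rightarrow> real \<Rightarrow> real \<Rightarrow> ennreal" where
  "divergence_gap \<alpha> f q =
     e2ennreal (h_alpha \<alpha> (q / f) * ereal f + ereal (2 / (1 - \<alpha>) * (q - f)))"

lemma borel_measurable_divergence_gap [measurable (raw)]:
  "f \<in> borel_measurable M \<Longrightarrow> g \<in> borel_measurable M \<Longrightarrow>
    (\<lambda>x. divergence_gap \<alpha> (f x) (g x)) \<in> borel_measurable M"
  unfolding divergence_gap_def
  by (intro measurable_compose[OF _ measurable_e2ennreal] borel_measurable_ereal_add
        borel_measurable_ereal_times borel_measurable_ereal
        measurable_compose[OF _ borel_measurable_h_alpha]) auto

lemma divergence_gap_eq:
  assumes "0 < f"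
  shows "divergence_gap \<alpha> f q =
    (if \<alpha> = -1 \<and> q = 0 then \<top>
     else ennreal (h_alpha_fin \<alpha> (q / f) * f + 2 / (1 - \<alpha>) * (q - f)))"
  using assms by (simp add: divergence_gap_def h_alpha_eq flip: infinity_ennreal_def)

lemma divergence_gap_nonneg:
  assumes "-1 \<le> \<alpha>" "\<alpha> < 1" "0 < f" "0 \<le> q" "\<not> (\<alpha> = -1 \<and> q = 0)"
  shows "0 \<le> h_alpha_fin \<alpha> (q / f) * f + 2 / (1 - \<alpha>) * (q - f)"
proof -
  have "0 \<le> (h_alpha_fin \<alpha> (q / f) + 2 / (1 - \<alpha>) * (q / f - 1)) * f"
    using assms by (intro mult_nonneg_nonneg h_alpha_fin_tangent_nonneg) auto
  also have "\<dots> = h_alpha_fin \<alpha> (q / f) * f + 2 / (1 - \<alpha>) * (q - f)"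
    using assms by (simp add: distrib_right diff_divide_distrib left_diff_distrib mult.assoc)
  finally show ?thesis .
qed

lemma divergence_gap_eq_0_iff:
  assumes "-1 \<le> \<alpha>" "\<alpha> < 1" "0 < f" "0 \<le> q"
  shows "divergence_gap \<alpha> f q = 0 \<longleftrightarrow> q = f"
proof
  assume 0: "divergence_gap \<alpha> f q = 0"
  then have n: "\<not> (\<alpha> = -1 \<and> q = 0)" using assms by (auto simp: divergence_gap_eq)
  with 0 have "h_alpha_fin \<alpha> (q / f) * f + 2 / (1 - \<alpha>) * (q - f) = 0"
    using divergence_gap_nonneg[OF assms n] assms by (auto simp: divergence_gap_eq ennreal_eq_0_iff)
  moreover have "h_alpha_fin \<alpha> (q / f) * f + 2 / (1 - \<alpha>) * (q - f) =
      (h_alpha_fin \<alpha> (q / f) + 2 / (1 - \<alpha>) * (q / f - 1)) * f"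
    using assms by (simp add: distrib_right diff_divide_distrib left_diff_distrib mult.assoc)
  ultimately have "h_alpha_fin \<alpha> (q / f) + 2 / (1 - \<alpha>) * (q / f - 1) = 0"
    using assms by auto
  then have "q / f = 1" using assms n by (intro h_alpha_fin_tangent_eq_0[of \<alpha>]) auto
  then show "q = f" using assms by simp
qed (use assms in \<open>simp add: divergence_gap_eq\<close>)

text \<open>The terms linear in \<open>q\<close> and \<open>s\<close> are distributed over both sides so that only nonnegative terms
  occur; in this form the identity remains valid where the gap is infinite, and it can be integrated
  term by term.\<close>

lemma divergence_gap_compensation:
  assumes \<alpha>: "-1 \<le> \<alpha>" "\<alpha> < 1" and pos: "0 < f" "0 < s" "0 \<le> q"
  defines "w \<equiv> (f / s) powr ((1 - \<alpha>) / 2)" and "\<nu> \<equiv> 2 / (1 - \<alpha>)"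
  shows "divergence_gap \<alpha> f q + ennreal w * ennreal (\<nu> * q) + ennreal (\<nu> * s) =
    divergence_gap \<alpha> f s + ennreal w * divergence_gap \<alpha> s q
      + ennreal w * ennreal (\<nu> * s) + ennreal (\<nu> * q)"
proof (cases "\<alpha> = -1 \<and> q = 0")
  case True
  have "w > 0" using pos by (simp add: w_def)
  then show ?thesis using True pos by (simp add: divergence_gap_eq ennreal_mult_top)
next
  case False
  have [simp]: "w \<ge> 0" "\<nu> \<ge> 0" using \<alpha> by (auto simp: w_def \<nu>_def)
  define a b c where "a = h_alpha_fin \<alpha> (q / f) * f + \<nu> * (q - f)"
    and "b = h_alpha_fin \<alpha> (s / f) * f + \<nu> * (s - f)"
    and "c = h_alpha_fin \<alpha> (q / s) * s + \<nu> * (q - s)"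
  have nn: "a \<ge> 0" "b \<ge> 0" "c \<ge> 0"
    unfolding a_def b_def c_def \<nu>_def using \<alpha> pos False
    by (intro divergence_gap_nonneg; auto)+
  have "a + w * (\<nu> * q) + \<nu> * s = b + w * c + w * (\<nu> * s) + \<nu> * q"
    using h_alpha_fin_change_reference[OF pos False]
    by (simp add: a_def b_def c_def flip: w_def) (simp add: algebra_simps)
  then have "ennreal (a + w * (\<nu> * q) + \<nu> * s) = ennreal (b + w * c + w * (\<nu> * s) + \<nu> * q)"
    by simp
  then have "ennreal a + ennreal w * ennreal (\<nu> * q) + ennreal (\<nu> * s) =
      ennreal b + ennreal w * ennreal c + ennreal w * ennreal (\<nu> * s) + ennreal (\<nu> * q)"
    using nn pos by (simp add: ennreal_mult)
  then show ?thesis using False pos by (auto simp: divergence_gap_eq a_def b_def c_def \<nu>_def)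
qed

section \<open>Losses as integrals of the divergence gap\<close>

text \<open>As \<open>u \<ge> - k\<close>, the negative part of \<open>u\<close> has finite integral and can be cancelled; an infinite positive
  part does no harm.\<close>

lemma ext_integral_add_null:
  fixes k :: "'a \<Rightarrow> real"
  assumes [measurable]: "u \<in> borel_measurable M"
    and k: "integrable M k" "(\<integral>x. k x \<partial>M) = 0"
    and nonneg: "\<And>x. 0 \<le> u x + ereal (k x)"
  shows "ext_integral M u = enn2ereal (\<integral>\<^sup>+x. e2ennreal (u x + ereal (k x)) \<partial>M)"
proof -
  have [measurable]: "k \<in> borel_measurable M" using k by auto
  have [measurable]: "(\<lambda>x. e2ennreal (u x + ereal (k x))) \<in> borel_measurable M"
    by (intro measurable_compose[OF _ measurable_e2ennreal] borel_measurable_ereal_add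
        borel_measurable_ereal) auto
  define K where "K = (\<integral>\<^sup>+x. ennreal (k x) \<partial>M)"
  define V where "V = (\<integral>\<^sup>+x. e2ennreal (u x + ereal (k x)) \<partial>M)"
  define P where "P = (\<integral>\<^sup>+x. e2ennreal (u x) \<partial>M)"
  define N where "N = (\<integral>\<^sup>+x. e2ennreal (- u x) \<partial>M)"
  have K_fin: "K < \<top>"
    using k(1) unfolding K_def by (simp add: real_integrable_def top.not_eq_extremum)
  have K_eq: "K = (\<integral>\<^sup>+x. ennreal (- k x) \<partial>M)"
  proof -
    have fin: "(\<integral>\<^sup>+x. ennreal (- k x) \<partial>M) < \<top>"
      using k(1) by (simp add: real_integrable_def top.not_eq_extremum)
    have "enn2real K = enn2real (\<integral>\<^sup>+x. ennreal (- k x) \<partial>M)"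
      using k(2) real_lebesgue_integral_def[OF k(1)] by (simp add: K_def)
    then show ?thesis using fin K_fin
      by (metis ennreal_enn2real)
  qed
  \<comment> \<open>\<open>u + k\<close> in terms of positive and negative parts, rearranged to avoid subtraction.\<close>
  have split: "e2ennreal (u x) + ennreal (k x) =
      e2ennreal (u x + ereal (k x)) + e2ennreal (- u x) + ennreal (- k x)" for x
  proof (cases "u x")
    case (real r)
    then have "0 \<le> r + k x" using nonneg[of x] by simp
    then show ?thesis using real by (auto simp: ennreal_plus_if ennreal_neg ennreal_plus[symmetric] simp del: ennreal_plus)
  next
    case PInf
    then show ?thesis by (simp add: e2ennreal_neg flip: infinity_ennreal_def)
  next
    case MInf
    then show ?thesis using nonneg[of x] by simp
  qed
  have "P + K = V + N + K"
    unfolding P_def V_def N_def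
    by (subst (2) K_eq, unfold K_def)
      (simp add: nn_integral_add[symmetric] split)
  then have PVN: "P = V + N" using K_fin
    by (metis add.commute ennreal_add_left_cancel less_irrefl infinity_ennreal_def)
  have "N \<le> K" unfolding N_def K_def
  proof (intro nn_integral_mono)
    fix x
    have "- u x \<le> ereal (k x)" using nonneg[of x] by (cases "u x") auto
    then show "e2ennreal (- u x) \<le> ennreal (k x)"
      using e2ennreal_mono by fastforce
  qed
  then have "N < \<top>" using K_fin by simp
  then have "enn2ereal (V + N) - enn2ereal N = enn2ereal V"
    by (cases V; cases N) (auto simp: plus_ennreal.rep_eq)
  then show ?thesis
    unfolding ext_integral_def using PVN by (simp add: P_def N_def V_def)
qed

lemma ext_integral_enn2ereal:
  "ext_integral M (\<lambda>x. enn2ereal (f x)) = enn2ereal (\<integral>\<^sup>+x. f x \<partial>M)"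
  by (simp add: ext_integral_def e2ennreal_neg zero_ennreal.rep_eq)

lemma is_density_normal_density: "0 < \<sigma> \<Longrightarrow> is_density (normal_density \<mu> \<sigma>)"
  by (simp add: is_density_def nn_integral_eq_integral)

lemma is_densityD:
  assumes "is_density q"
  shows is_density_measurable: "q \<in> borel_measurable borel"
    and is_density_nonneg: "0 \<le> q y"
    and is_density_nn_integral: "(\<integral>\<^sup>+y. ennreal (q y) \<partial>lborel) = 1"
    and is_density_integrable: "integrable lborel q"
    and is_density_integral: "(\<integral>y. q y \<partial>lborel) = 1"
proof -
  show [measurable]: "q \<in> borel_measurable borel" and nn: "\<And>y. 0 \<le> q y"
    and 1: "(\<integral>\<^sup>+y. ennreal (q y) \<partial>lborel) = 1"
    using assms by (auto simp: is_density_def)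
  show "integrable lborel q" using 1 nn by (intro integrableI_nonneg) auto
  show "(\<integral>y. q y \<partial>lborel) = 1" using 1 nn by (subst integral_eq_nn_integral) auto
qed

lemma alpha_loss_eq_gap:
  assumes \<alpha>: "-1 \<le> \<alpha>" "\<alpha> < 1" and "0 < \<sigma>Y" and q: "is_density q"
  shows "alpha_loss \<alpha> \<sigma>Y \<theta> q =
    enn2ereal (\<integral>\<^sup>+y. divergence_gap \<alpha> (normal_density (fst \<theta>) \<sigma>Y y) (q y) \<partial>lborel)"
proof -
  note [measurable] = is_density_measurable[OF q]
  let ?f = "normal_density (fst \<theta>) \<sigma>Y"
  have f: "is_density ?f" using assms by (simp add: is_density_normal_density)
  have fpos: "?f y > 0" for y using assms by (simp add: normal_density_pos)
  show ?thesis
    unfolding alpha_loss_def divergence_gap_def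
  proof (rule ext_integral_add_null)
    show "(\<lambda>y. h_alpha \<alpha> (q y / ?f y) * ereal (?f y)) \<in> borel_measurable lborel"
      by (intro borel_measurable_ereal_times borel_measurable_ereal
        measurable_compose[OF _ borel_measurable_h_alpha]) auto
    show "integrable lborel (\<lambda>y. 2 / (1 - \<alpha>) * (q y - ?f y))"
      using is_density_integrable[OF q] is_density_integrable[OF f] by auto
    show "(\<integral>y. 2 / (1 - \<alpha>) * (q y - ?f y) \<partial>lborel) = 0"
      using is_densityD(4,5)[OF q] is_densityD(4,5)[OF f] by simp
    show "0 \<le> h_alpha \<alpha> (q y / ?f y) * ereal (?f y) + ereal (2 / (1 - \<alpha>) * (q y - ?f y))" for y
      using divergence_gap_nonneg[OF \<alpha> fpos is_density_nonneg[OF q], of y y] fpos[of y]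
      by (auto simp: h_alpha_eq)
  qed
qed

lemma posterior_expected_loss_eq_gap:
  assumes "-1 \<le> \<alpha>" "\<alpha> < 1" "0 < \<sigma>Y" "is_density q"
  shows "posterior_expected_loss \<alpha> \<sigma>1 \<sigma>2 \<sigma>Y \<pi> x q =
    enn2ereal (\<integral>\<^sup>+\<theta>. \<integral>\<^sup>+y. divergence_gap \<alpha> (normal_density (fst \<theta>) \<sigma>Y y) (q y)
      \<partial>lborel \<partial>posterior \<sigma>1 \<sigma>2 \<pi> x)"
  unfolding posterior_expected_loss_def
  by (subst alpha_loss_eq_gap[OF assms]) (rule ext_integral_enn2ereal)

lemma borel_measurable_normal_density_mean [measurable (raw)]:
  assumes [measurable]: "f \<in> borel_measurable M" "g \<in> borel_measurable M"
  shows "(\<lambda>x. normal_density (f x) \<sigma> (g x)) \<in> borel_measurable M"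
  unfolding normal_density_def by measurable

lemma borel_measurable_fst_snd:
  "(fst :: real \<times> real \<Rightarrow> real) \<in> borel_measurable borel"
  "(snd :: real \<times> real \<Rightarrow> real) \<in> borel_measurable borel"
  by (auto simp flip: borel_prod)

lemma sets_posterior [measurable_cong, simp]: "sets (posterior \<sigma>1 \<sigma>2 \<pi> x) = sets borel"
  by (simp add: posterior_def)

section \<open>Minimization of the posterior expected loss\<close>

text \<open>Average the pointwise compensation identity over \<open>P\<close>, where the weight \<open>(f / s) powr ((1 - \<alpha>) / 2)\<close>
  has mean \<open>\<kappa>\<close>, and integrate over \<open>y\<close>. Since \<open>q\<close> and \<open>s\<close> have the same total mass, the linear terms
  contribute the same finite amount to both sides and cancel.\<close>

lemma expected_gap_compensation:
  fixes f :: "'a \<Rightarrow> real \<Rightarrow> real"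
  assumes \<alpha>: "-1 \<le> \<alpha>" "\<alpha> < 1" and P: "prob_space P"
    and meas [measurable]: "(\<lambda>(\<theta>, y). f \<theta> y) \<in> borel_measurable (P \<Otimes>\<^sub>M borel)"
    and fpos: "\<And>\<theta> y. 0 < f \<theta> y"
    and s: "is_density s" and spos: "\<And>y. 0 < s y" and "0 \<le> \<kappa>"
    and mean: "\<And>y. (\<integral>\<^sup>+\<theta>. ennreal (f \<theta> y powr ((1 - \<alpha>) / 2)) \<partial>P) =
      ennreal (\<kappa> * s y powr ((1 - \<alpha>) / 2))"
    and q: "is_density q"
  shows "(\<integral>\<^sup>+\<theta>. \<integral>\<^sup>+y. divergence_gap \<alpha> (f \<theta> y) (q y) \<partial>lborel \<partial>P) =
    (\<integral>\<^sup>+\<theta>. \<integral>\<^sup>+y. divergence_gap \<alpha> (f \<theta> y) (s y) \<partial>lborel \<partial>P)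
      + ennreal \<kappa> * (\<integral>\<^sup>+y. divergence_gap \<alpha> (s y) (q y) \<partial>lborel)"
proof -
  interpret P: prob_space P by fact
  interpret pair_sigma_finite P lborel ..
  note [measurable] = is_density_measurable[OF s] is_density_measurable[OF q]
  note q_nn = is_density_nonneg[OF q]
  define \<nu> where "\<nu> = 2 / (1 - \<alpha>)"
  have "\<nu> \<ge> 0" using \<alpha> by (simp add: \<nu>_def)
  define G where "G r y = (\<integral>\<^sup>+\<theta>. divergence_gap \<alpha> (f \<theta> y) (r y) \<partial>P)" for r y
  have swap: "(\<integral>\<^sup>+\<theta>. \<integral>\<^sup>+y. divergence_gap \<alpha> (f \<theta> y) (r y) \<partial>lborel \<partial>P) = (\<integral>\<^sup>+y. G r y \<partial>lborel)"
    if [measurable]: "r \<in> borel_measurable borel" for r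
    unfolding G_def by (rule Fubini'[symmetric]) measurable
  have G_meas [measurable]: "G r \<in> borel_measurable borel"
    if [measurable]: "r \<in> borel_measurable borel" for r
    unfolding G_def by measurable
  define w where "w \<theta> y = (f \<theta> y / s y) powr ((1 - \<alpha>) / 2)" for \<theta> y
  have f_y [measurable]: "(\<lambda>\<theta>. f \<theta> y) \<in> borel_measurable P" for y
    using measurable_compose_Pair1[OF _ measurable_compose[OF measurable_pair_swap' meas], of y]
    by simp
  have w_y [measurable]: "(\<lambda>\<theta>. w \<theta> y) \<in> borel_measurable P" for y
    unfolding w_def by measurable
  have mean_w: "(\<integral>\<^sup>+\<theta>. ennreal (w \<theta> y) \<partial>P) = ennreal \<kappa>" for y
  proof -
    have sp: "s y powr ((1 - \<alpha>) / 2) > 0" using spos[of y] by simp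
    have "(\<integral>\<^sup>+\<theta>. ennreal (w \<theta> y) \<partial>P) =
        (\<integral>\<^sup>+\<theta>. ennreal (f \<theta> y powr ((1 - \<alpha>) / 2)) * ennreal (1 / s y powr ((1 - \<alpha>) / 2)) \<partial>P)"
      using spos[of y] fpos[of _ y]
      by (intro nn_integral_cong) (simp add: w_def powr_divide ennreal_mult[symmetric] less_imp_le)
    also have "\<dots> = ennreal (\<kappa> * s y powr ((1 - \<alpha>) / 2)) * ennreal (1 / s y powr ((1 - \<alpha>) / 2))"
      by (subst nn_integral_multc) (auto simp: mean)
    also have "\<dots> = ennreal \<kappa>"
      using sp \<open>0 \<le> \<kappa>\<close> by (simp add: ennreal_mult[symmetric])
    finally show ?thesis .
  qed
  have pointwise: "G q y + ennreal \<kappa> * ennreal (\<nu> * q y) + ennreal (\<nu> * s y) =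
      G s y + ennreal \<kappa> * divergence_gap \<alpha> (s y) (q y) + ennreal \<kappa> * ennreal (\<nu> * s y)
        + ennreal (\<nu> * q y)" for y
  proof -
    have "(\<integral>\<^sup>+\<theta>. divergence_gap \<alpha> (f \<theta> y) (q y) + ennreal (w \<theta> y) * ennreal (\<nu> * q y)
          + ennreal (\<nu> * s y) \<partial>P) =
        (\<integral>\<^sup>+\<theta>. divergence_gap \<alpha> (f \<theta> y) (s y) + ennreal (w \<theta> y) * divergence_gap \<alpha> (s y) (q y)
          + ennreal (w \<theta> y) * ennreal (\<nu> * s y) + ennreal (\<nu> * q y) \<partial>P)"
      unfolding w_def \<nu>_def
      by (intro nn_integral_cong divergence_gap_compensation \<alpha> fpos spos q_nn)
    then show ?thesis
      by (simp add: nn_integral_add nn_integral_multc mean_w P.emeasure_space_1 flip: G_def)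
  qed
  have int_\<nu>: "(\<integral>\<^sup>+y. ennreal (\<nu> * r y) \<partial>lborel) = ennreal \<nu>" if r: "is_density r" for r
    using is_densityD[OF r] \<open>\<nu> \<ge> 0\<close> by (simp add: ennreal_mult nn_integral_cmult)
  have "(\<integral>\<^sup>+y. G q y + ennreal \<kappa> * ennreal (\<nu> * q y) + ennreal (\<nu> * s y) \<partial>lborel) =
      (\<integral>\<^sup>+y. G s y + ennreal \<kappa> * divergence_gap \<alpha> (s y) (q y) + ennreal \<kappa> * ennreal (\<nu> * s y)
        + ennreal (\<nu> * q y) \<partial>lborel)"
    by (simp only: pointwise)
  then have "(\<integral>\<^sup>+y. G q y \<partial>lborel) + (ennreal \<kappa> * ennreal \<nu> + ennreal \<nu>) =
      ((\<integral>\<^sup>+y. G s y \<partial>lborel) + ennreal \<kappa> * (\<integral>\<^sup>+y. divergence_gap \<alpha> (s y) (q y) \<partial>lborel))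
        + (ennreal \<kappa> * ennreal \<nu> + ennreal \<nu>)"
    by (simp add: nn_integral_add nn_integral_cmult int_\<nu> s q add.assoc)
  moreover have "ennreal \<kappa> * ennreal \<nu> + ennreal \<nu> < \<top>"
    by (simp add: ennreal_mult_less_top)
  ultimately show ?thesis
    by (subst (1 2) swap) (auto simp: ennreal_add_left_cancel add.commute)
qed

text \<open>A density \<open>r\<close> of finite risk guarantees that the risk of \<open>s\<close> is finite; were it infinite, the risk of
  every density would be infinite, and none would be singled out.\<close>

lemma bayes_predictive_density_if_powr_mean:
  assumes \<alpha>: "-1 \<le> \<alpha>" "\<alpha> < 1" and "0 < \<sigma>Y"
    and P: "prob_space (posterior \<sigma>1 \<sigma>2 \<pi> x)"
    and s: "is_density s" and spos: "\<And>y. 0 < s y" and "0 < \<kappa>"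
    and mean: "\<And>y. (\<integral>\<^sup>+\<theta>. ennreal (normal_density (fst \<theta>) \<sigma>Y y powr ((1 - \<alpha>) / 2))
        \<partial>posterior \<sigma>1 \<sigma>2 \<pi> x) = ennreal (\<kappa> * s y powr ((1 - \<alpha>) / 2))"
    and r: "is_density r"
      "(\<integral>\<^sup>+\<theta>. \<integral>\<^sup>+y. divergence_gap \<alpha> (normal_density (fst \<theta>) \<sigma>Y y) (r y) \<partial>lborel
        \<partial>posterior \<sigma>1 \<sigma>2 \<pi> x) < \<top>"
  shows "is_bayes_predictive_density \<alpha> \<sigma>1 \<sigma>2 \<sigma>Y \<pi> x s"
    and "is_bayes_predictive_density \<alpha> \<sigma>1 \<sigma>2 \<sigma>Y \<pi> x q \<Longrightarrow> AE y in lborel. q y = s y"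
proof -
  define R where "R q = (\<integral>\<^sup>+\<theta>. \<integral>\<^sup>+y. divergence_gap \<alpha> (normal_density (fst \<theta>) \<sigma>Y y) (q y) \<partial>lborel
        \<partial>posterior \<sigma>1 \<sigma>2 \<pi> x)" for q
  have loss: "posterior_expected_loss \<alpha> \<sigma>1 \<sigma>2 \<sigma>Y \<pi> x q = enn2ereal (R q)" if "is_density q" for q
    unfolding R_def using assms that by (intro posterior_expected_loss_eq_gap)
  note [measurable] = borel_measurable_fst_snd
  have [measurable]: "(\<lambda>(\<theta>, y). normal_density (fst \<theta>) \<sigma>Y y)
      \<in> borel_measurable (posterior \<sigma>1 \<sigma>2 \<pi> x \<Otimes>\<^sub>M borel)"
    by measurable
  have R: "R q = R s + ennreal \<kappa> * (\<integral>\<^sup>+y. divergence_gap \<alpha> (s y) (q y) \<partial>lborel)"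
    if "is_density q" for q
    unfolding R_def
    using assms that by (intro expected_gap_compensation) (auto simp: normal_density_pos)
  have fin: "R s < \<top>"
  proof -
    have "R s \<le> R r" unfolding R[OF r(1)] by (rule add_increasing2) auto
    also have "R r < \<top>" using r(2) by (simp only: R_def)
    finally show ?thesis .
  qed
  show "is_bayes_predictive_density \<alpha> \<sigma>1 \<sigma>2 \<sigma>Y \<pi> x s"
    unfolding is_bayes_predictive_density_def
  proof (intro conjI allI impI s)
    fix q assume q: "is_density q"
    have "R s \<le> R q" unfolding R[OF q] by (rule add_increasing2) auto
    then show "posterior_expected_loss \<alpha> \<sigma>1 \<sigma>2 \<sigma>Y \<pi> x s \<le> posterior_expected_loss \<alpha> \<sigma>1 \<sigma>2 \<sigma>Y \<pi> x q"
      by (simp add: loss s q less_eq_ennreal.rep_eq)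
  qed
  show "AE y in lborel. q y = s y" if q: "is_bayes_predictive_density \<alpha> \<sigma>1 \<sigma>2 \<sigma>Y \<pi> x q"
  proof -
    have dq: "is_density q" and "R q \<le> R s"
      using q s by (auto simp: is_bayes_predictive_density_def loss less_eq_ennreal.rep_eq)
    note [measurable] = is_density_measurable[OF dq] is_density_measurable[OF s]
    have "R s + ennreal \<kappa> * (\<integral>\<^sup>+y. divergence_gap \<alpha> (s y) (q y) \<partial>lborel) \<le> R s + 0"
      using \<open>R q \<le> R s\<close> unfolding R[OF dq] by simp
    then have "ennreal \<kappa> * (\<integral>\<^sup>+y. divergence_gap \<alpha> (s y) (q y) \<partial>lborel) = 0"
      using fin unfolding ennreal_add_left_cancel_le by auto
    then have "(\<integral>\<^sup>+y. divergence_gap \<alpha> (s y) (q y) \<partial>lborel) = 0"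
      using \<open>0 < \<kappa>\<close> by (simp add: ennreal_eq_0_iff)
    then have "AE y in lborel. divergence_gap \<alpha> (s y) (q y) = 0"
      by (subst (asm) nn_integral_0_iff_AE) auto
    then show ?thesis
      by eventually_elim (simp add: divergence_gap_eq_0_iff \<alpha> spos is_density_nonneg[OF dq])
  qed
qed

section \<open>Integrals of normal densities\<close>

lemma normal_density_commute: "normal_density \<mu> \<sigma> x = normal_density x \<sigma> \<mu>"
  by (simp add: normal_density_def power2_commute)

lemma normal_density_affine_std:
  "0 < \<sigma> \<Longrightarrow> normal_density \<mu> \<sigma> t = std_normal_density ((t - \<mu>) / \<sigma>) / \<sigma>"
  by (simp add: normal_density_def power_divide real_sqrt_mult)

lemma borel_measurable_std_normal_cdf [measurable]: "std_normal_cdf \<in> borel_measurable borel"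
proof -
  interpret real_distribution std_normal_distribution by (rule real_dist_normal_dist)
  show ?thesis unfolding std_normal_cdf_def
    by (intro borel_measurable_mono monoI cdf_nondecreasing)
qed

lemma std_normal_cdf_eq_nn_integral:
  "ennreal (std_normal_cdf x) = (\<integral>\<^sup>+t. ennreal (std_normal_density t) * indicator {..x} t \<partial>lborel)"
proof -
  interpret real_distribution std_normal_distribution by (rule real_dist_normal_dist)
  show ?thesis unfolding std_normal_cdf_def cdf_def
    by (simp add: emeasure_eq_measure[symmetric] emeasure_density)
qed

lemma std_normal_cdf_le_1: "std_normal_cdf x \<le> 1"
proof -
  interpret real_distribution std_normal_distribution by (rule real_dist_normal_dist)
  show ?thesis unfolding std_normal_cdf_def by (rule cdf_bounded_prob)
qed

lemma std_normal_cdf_pos: "0 < std_normal_cdf x"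
proof -
  have "ennreal (std_normal_cdf x) \<noteq> 0"
  proof
    assume "ennreal (std_normal_cdf x) = 0"
    then have "AE t in lborel. ennreal (std_normal_density t) * indicator {..x} t = 0"
      unfolding std_normal_cdf_eq_nn_integral by (subst (asm) nn_integral_0_iff_AE) auto
    then have "AE t in lborel. t \<notin> {..x}"
      by eventually_elim (use normal_density_pos[of 1 0] in \<open>auto simp: indicator_def less_le split: if_splits\<close>)
    then have "AE t in lborel. t \<notin> {x-1..x}"
      by eventually_elim auto
    then have "{x-1..x} \<in> null_sets lborel"
      by (subst AE_iff_null_sets) auto
    then have "emeasure lborel {x-1..x} = 0" by (rule null_setsD1)
    then show False by simp
  qed
  then show ?thesis by (metis ennreal_neg not_less)
qed

lemma nn_integral_normal_density_atMost:
  assumes "0 < \<sigma>"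
  shows "(\<integral>\<^sup>+t. ennreal (normal_density \<mu> \<sigma> t) * indicator {..b} t \<partial>lborel) =
    ennreal (std_normal_cdf ((b - \<mu>) / \<sigma>))"
proof -
  have "(\<integral>\<^sup>+t. ennreal (normal_density \<mu> \<sigma> t) * indicator {..b} t \<partial>lborel) =
      ennreal \<bar>\<sigma>\<bar> * (\<integral>\<^sup>+t. ennreal (normal_density \<mu> \<sigma> (\<mu> + \<sigma> * t)) * indicator {..b} (\<mu> + \<sigma> * t) \<partial>lborel)"
    using assms by (intro nn_integral_real_affine) auto
  also have "\<dots> = (\<integral>\<^sup>+t. ennreal (std_normal_density t) * indicator {..(b - \<mu>) / \<sigma>} t \<partial>lborel)"
  proof -
    have "ennreal \<bar>\<sigma>\<bar> * (ennreal (normal_density \<mu> \<sigma> (\<mu> + \<sigma> * t)) * indicator {..b} (\<mu> + \<sigma> * t)) =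
        ennreal (std_normal_density t) * indicator {..(b - \<mu>) / \<sigma>} t" for t
    proof -
      have "\<mu> + \<sigma> * t \<le> b \<longleftrightarrow> t \<le> (b - \<mu>) / \<sigma>" using assms by (simp add: field_simps)
      moreover have "\<bar>\<sigma>\<bar> * normal_density \<mu> \<sigma> (\<mu> + \<sigma> * t) = std_normal_density t"
        using assms by (simp add: normal_density_affine_std[of \<sigma>])
      ultimately show ?thesis
        by (simp add: indicator_def flip: ennreal_mult')
    qed
    then show ?thesis by (subst nn_integral_cmult[symmetric]) auto
  qed
  finally show ?thesis by (simp add: std_normal_cdf_eq_nn_integral)
qed

text \<open>The density at \<open>d\<close> of the difference of two independent normal variables.\<close>

lemma nn_integral_normal_density_mult_shift:
  assumes "0 < s" "0 < \<tau>"
  shows "(\<integral>\<^sup>+t. ennreal (normal_density m s t * normal_density \<mu> \<tau> (t - d)) \<partial>lborel) =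
    ennreal (normal_density (m - \<mu>) (sqrt (s\<^sup>2 + \<tau>\<^sup>2)) d)"
proof -
  have "(\<integral>\<^sup>+t. ennreal (normal_density m s t * normal_density \<mu> \<tau> (t - d)) \<partial>lborel) =
      ennreal \<bar>1\<bar> * (\<integral>\<^sup>+t. ennreal (normal_density m s (m + 1 * t) * normal_density \<mu> \<tau> (m + 1 * t - d)) \<partial>lborel)"
    by (intro nn_integral_real_affine) auto
  also have "\<dots> = (\<integral>\<^sup>+t. ennreal (normal_density 0 \<tau> ((d + \<mu> - m) - t) * normal_density 0 s t) \<partial>lborel)"
    by (auto intro!: nn_integral_cong simp: normal_density_def power2_commute algebra_simps)
  also have "\<dots> = ennreal (normal_density 0 (sqrt (\<tau>\<^sup>2 + s\<^sup>2)) (d + \<mu> - m))"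
    using fun_cong[OF conv_normal_density_zero_mean[OF assms(2,1)], of "d + \<mu> - m"] by simp
  also have "normal_density 0 (sqrt (\<tau>\<^sup>2 + s\<^sup>2)) (d + \<mu> - m) =
      normal_density (m - \<mu>) (sqrt (s\<^sup>2 + \<tau>\<^sup>2)) d"
    by (simp add: normal_density_def algebra_simps)
  finally show ?thesis .
qed

text \<open>Both sides are the probability that \<open>T - U \<ge> 0\<close> for independent \<open>T\<close> and \<open>U\<close>, normal with means
  \<open>m\<close>, \<open>\<mu>\<close> and standard deviations \<open>s\<close>, \<open>\<tau>\<close>.\<close>

lemma nn_integral_normal_density_times_cdf:
  assumes "0 < s" "0 < \<tau>"
  shows "(\<integral>\<^sup>+t. ennreal (normal_density m s t * std_normal_cdf ((t - \<mu>) / \<tau>)) \<partial>lborel) =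
    ennreal (std_normal_cdf ((m - \<mu>) / sqrt (s\<^sup>2 + \<tau>\<^sup>2)))"
proof -
  \<comment> \<open>Substituting \<open>u = t - d\<close> makes the range of integration independent of \<open>t\<close>.\<close>
  define S where "S = sqrt (s\<^sup>2 + \<tau>\<^sup>2)"
  have S: "S > 0" using assms by (simp add: S_def add_pos_pos)
  have cdf: "ennreal (std_normal_cdf ((t - \<mu>) / \<tau>)) =
      (\<integral>\<^sup>+d. ennreal (normal_density \<mu> \<tau> (t - d)) * indicator {0..} d \<partial>lborel)" for t
  proof -
    have "ennreal (std_normal_cdf ((t - \<mu>) / \<tau>)) =
      (\<integral>\<^sup>+u. ennreal (normal_density \<mu> \<tau> u) * indicator {..t} u \<partial>lborel)"
      using assms by (simp add: nn_integral_normal_density_atMost)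
    also have "\<dots> = ennreal \<bar>-1\<bar> *
        (\<integral>\<^sup>+d. ennreal (normal_density \<mu> \<tau> (t + -1 * d)) * indicator {..t} (t + -1 * d) \<partial>lborel)"
      by (intro nn_integral_real_affine) auto
    finally show ?thesis by (simp add: indicator_def)
  qed
  have "(\<integral>\<^sup>+t. ennreal (normal_density m s t * std_normal_cdf ((t - \<mu>) / \<tau>)) \<partial>lborel) =
      (\<integral>\<^sup>+t. \<integral>\<^sup>+d. ennreal (normal_density m s t * normal_density \<mu> \<tau> (t - d)) * indicator {0..} d
        \<partial>lborel \<partial>lborel)"
    by (intro nn_integral_cong)
      (simp add: ennreal_mult' cdf nn_integral_cmult[symmetric] mult.assoc)
  also have "\<dots> = (\<integral>\<^sup>+d. \<integral>\<^sup>+t. ennreal (normal_density m s t * normal_density \<mu> \<tau> (t - d)) * indicator {0..} d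
        \<partial>lborel \<partial>lborel)"
    by (rule lborel_pair.Fubini') measurable
  also have "\<dots> = (\<integral>\<^sup>+d. ennreal (normal_density (m - \<mu>) S d) * indicator {0..} d \<partial>lborel)"
    by (simp add: nn_integral_multc nn_integral_normal_density_mult_shift assms S_def)
  also have "\<dots> = ennreal \<bar>-1\<bar> *
      (\<integral>\<^sup>+d. ennreal (normal_density (m - \<mu>) S (0 + -1 * d)) * indicator {0..} (0 + -1 * d) \<partial>lborel)"
    by (intro nn_integral_real_affine) auto
  also have "\<dots> = (\<integral>\<^sup>+d. ennreal (normal_density (\<mu> - m) S d) * indicator {..0} d \<partial>lborel)"
    by (auto intro!: nn_integral_cong
        simp: normal_density_def power2_commute indicator_def algebra_simps)
  also have "\<dots> = ennreal (std_normal_cdf ((m - \<mu>) / S))"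
    using S by (simp add: nn_integral_normal_density_atMost)
  finally show ?thesis by (simp add: S_def)
qed

text \<open>Bayes' theorem for normal distributions: with \<open>t\<close> normal around \<open>x\<close> and \<open>y\<close> normal around \<open>t\<close>,
  the joint density is the marginal density of \<open>y\<close> times the density of \<open>t\<close> given \<open>y\<close>. The proof
  completes the square in \<open>t\<close>.\<close>

lemma normal_density_mult:
  assumes "0 < a" "0 < b"
  shows "normal_density y a t * normal_density x b t =
    normal_density x (sqrt (b\<^sup>2 + a\<^sup>2)) y *
    normal_density (x + b\<^sup>2 / (b\<^sup>2 + a\<^sup>2) * (y - x)) (sqrt (a\<^sup>2 * (b\<^sup>2 / (b\<^sup>2 + a\<^sup>2)))) t"
proof -
  define A B where "A = a\<^sup>2" and "B = b\<^sup>2"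
  have pos: "A > 0" "B > 0" using assms by (auto simp: A_def B_def)
  then have S: "B + A > 0" by simp
  have sq: "sqrt (2 * pi * A) * sqrt (2 * pi * B) =
      sqrt (2 * pi * (B + A)) * sqrt (2 * pi * (A * (B / (B + A))))"
    using pos S by (simp flip: real_sqrt_mult)
  have e: "(t - y)\<^sup>2 / (2 * A) + (t - x)\<^sup>2 / (2 * B) =
      (y - x)\<^sup>2 / (2 * (B + A)) + (t - (x + B / (B + A) * (y - x)))\<^sup>2 / (2 * (A * (B / (B + A))))"
  proof -
    have "(t - (x + B / (B + A) * (y - x)))\<^sup>2 = ((t - x) * (B + A) - B * (y - x))\<^sup>2 / (B + A)\<^sup>2"
    proof -
      have "t - (x + B / (B + A) * (y - x)) = ((t - x) * (B + A) - B * (y - x)) / (B + A)"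
        using S by (simp add: diff_divide_distrib)
      then show ?thesis by (simp add: power_divide)
    qed
    then have "(t - (x + B / (B + A) * (y - x)))\<^sup>2 / (2 * (A * (B / (B + A)))) =
        ((t - x) * (B + A) - B * (y - x))\<^sup>2 / (2 * A * B * (B + A))"
      using pos S by (simp add: power2_eq_square)
    moreover have "(t - y)\<^sup>2 / (2 * A) + (t - x)\<^sup>2 / (2 * B) =
        ((B * (t - y)\<^sup>2 + A * (t - x)\<^sup>2) * (B + A)) / (2 * A * B * (B + A))"
      using pos S by (simp add: divide_simps)
    moreover have "(y - x)\<^sup>2 / (2 * (B + A)) = (A * B * (y - x)\<^sup>2) / (2 * A * B * (B + A))"
      using pos S by (simp add: divide_simps)
    moreover have "(B * (t - y)\<^sup>2 + A * (t - x)\<^sup>2) * (B + A) =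
        A * B * (y - x)\<^sup>2 + ((t - x) * (B + A) - B * (y - x))\<^sup>2"
      by (simp add: power2_eq_square algebra_simps)
    ultimately show ?thesis by (simp add: add_divide_distrib)
  qed
  have "normal_density y a t * normal_density x b t =
    1 / (sqrt (2 * pi * A) * sqrt (2 * pi * B)) * exp (- ((t - y)\<^sup>2 / (2 * A) + (t - x)\<^sup>2 / (2 * B)))"
    by (simp add: normal_density_def A_def B_def exp_add[symmetric] algebra_simps)
  also have "\<dots> = normal_density x (sqrt (B + A)) y *
    normal_density (x + B / (B + A) * (y - x)) (sqrt (A * (B / (B + A)))) t"
  proof -
    have split: "1 / (c * d) * exp (- (p / C + q / D)) = 1 / c * exp (- p / C) * (1 / d * exp (- q / D))"
      for c d p q C D :: real
      by (simp add: exp_diff exp_minus divide_inverse)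
    show ?thesis unfolding e sq split using pos S by (simp add: normal_density_def)
  qed
  finally show ?thesis by (simp add: A_def B_def)
qed

lemma normal_density_powr:
  assumes "0 < \<sigma>" "0 < n"
  obtains c where "0 < c"
    "\<And>\<mu> y. normal_density \<mu> \<sigma> y powr (1 / n) = c * normal_density \<mu> (sqrt n * \<sigma>) y"
proof
  let ?c = "sqrt (2 * pi * (sqrt n * \<sigma>)\<^sup>2) * (1 / sqrt (2 * pi * \<sigma>\<^sup>2)) powr (1 / n)"
  show "0 < ?c" using assms by simp
  show "normal_density \<mu> \<sigma> y powr (1 / n) = ?c * normal_density \<mu> (sqrt n * \<sigma>) y" for \<mu> y
  proof -
    have "exp (- (y - \<mu>)\<^sup>2 / (2 * \<sigma>\<^sup>2)) powr (1 / n) = exp (- (y - \<mu>)\<^sup>2 / (2 * (sqrt n * \<sigma>)\<^sup>2))"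
      using assms by (simp add: exp_powr_real power_mult_distrib field_simps)
    moreover have "sqrt (2 * pi * (sqrt n * \<sigma>)\<^sup>2) > 0" using assms by simp
    ultimately show ?thesis
      unfolding normal_density_def using assms by (subst powr_mult) auto
  qed
qed

text \<open>Up to the factor \<open>2 / (1 - \<alpha>)\<close>, the integrand is bounded through \<open>h_alpha_fin_le_ln\<close> by
  \<open>f * ln (f / q) + q\<close>, where the log-ratio is a difference of two quadratics in \<open>y\<close>; the negative one is
  dropped.\<close>

lemma nn_integral_gap_normal_le:
  assumes \<alpha>: "-1 \<le> \<alpha>" "\<alpha> < 1" and \<sigma>: "0 < \<sigma>"
  shows "(\<integral>\<^sup>+y. divergence_gap \<alpha> (normal_density t \<sigma> y) (normal_density m \<sigma> y) \<partial>lborel) \<le>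
    ennreal (2 / (1 - \<alpha>) * ((\<sigma>\<^sup>2 + (t - m)\<^sup>2) / (2 * \<sigma>\<^sup>2) + 1))"
proof -
  define \<nu> where "\<nu> = 2 / (1 - \<alpha>)"
  have \<nu>: "\<nu> > 0" using \<alpha> by (simp add: \<nu>_def)
  let ?f = "normal_density t \<sigma>" and ?q = "normal_density m \<sigma>"
  let ?B = "\<lambda>y. \<nu> * (?f y * ((y - m)\<^sup>2 / (2 * \<sigma>\<^sup>2)) + ?q y)"
  have pos: "?f y > 0" "?q y > 0" for y using \<sigma> by (auto simp: normal_density_pos)
  have "divergence_gap \<alpha> (?f y) (?q y) \<le> ennreal (?B y)" for y
  proof -
    have "ln (?f y) - ln (?q y) = (y - m)\<^sup>2 / (2 * \<sigma>\<^sup>2) - (y - t)\<^sup>2 / (2 * \<sigma>\<^sup>2)"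
      using \<sigma> by (simp add: normal_density_def ln_mult ln_div)
    then have "- ln (?q y / ?f y) \<le> (y - m)\<^sup>2 / (2 * \<sigma>\<^sup>2)"
      using pos[of y] by (simp add: ln_div)
    then have "\<nu> * - ln (?q y / ?f y) \<le> \<nu> * ((y - m)\<^sup>2 / (2 * \<sigma>\<^sup>2))"
      using \<nu> by (intro mult_left_mono) auto
    then have "h_alpha_fin \<alpha> (?q y / ?f y) \<le> \<nu> * ((y - m)\<^sup>2 / (2 * \<sigma>\<^sup>2))"
      using h_alpha_fin_le_ln[OF \<alpha>, of "?q y / ?f y"] pos[of y] by (simp add: \<nu>_def)
    then have "h_alpha_fin \<alpha> (?q y / ?f y) * ?f y \<le> \<nu> * ((y - m)\<^sup>2 / (2 * \<sigma>\<^sup>2)) * ?f y"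
      by (rule mult_right_mono) simp
    moreover have "\<nu> * (?q y - ?f y) \<le> \<nu> * ?q y" using pos[of y] \<nu> by (intro mult_left_mono) auto
    ultimately have "h_alpha_fin \<alpha> (?q y / ?f y) * ?f y + \<nu> * (?q y - ?f y) \<le> ?B y"
      by (simp add: distrib_left mult_ac)
    then show ?thesis using pos[of y] by (auto simp: divergence_gap_eq \<nu>_def intro!: ennreal_leI)
  qed
  then have "(\<integral>\<^sup>+y. divergence_gap \<alpha> (?f y) (?q y) \<partial>lborel) \<le> (\<integral>\<^sup>+y. ennreal (?B y) \<partial>lborel)"
    by (intro nn_integral_mono)
  also have "\<dots> = ennreal (\<nu> * ((\<sigma>\<^sup>2 + (t - m)\<^sup>2) / (2 * \<sigma>\<^sup>2) + 1))"
  proof (rule nn_integral_eq_integral[THEN trans])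
    \<comment> \<open>Expand \<open>y - m = (y - t) + (t - m)\<close> to use the central moments of \<open>?f\<close>.\<close>
    have sq: "?f y * ((y - m)\<^sup>2 / (2 * \<sigma>\<^sup>2)) =
        (?f y * (y - t)\<^sup>2 + 2 * (t - m) * (?f y * (y - t)) + (t - m)\<^sup>2 * ?f y) / (2 * \<sigma>\<^sup>2)" for y
      using \<sigma> by (simp add: field_simps) (simp add: power2_eq_square algebra_simps)
    have i2: "integrable lborel (\<lambda>y. ?f y * (y - t)\<^sup>2)" "(\<integral>y. ?f y * (y - t)\<^sup>2 \<partial>lborel) = \<sigma>\<^sup>2"
      using integrable_normal_moment[OF \<sigma>, of t 2] integral_normal_moment_even[OF \<sigma>, of t 1] by auto
    have i1: "integrable lborel (\<lambda>y. ?f y * (y - t))" "(\<integral>y. ?f y * (y - t) \<partial>lborel) = 0"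
      using integrable_normal_moment[OF \<sigma>, of t 1] integral_normal_moment_odd[OF \<sigma>, of t 0] by auto
    show "integrable lborel ?B" unfolding sq using i1 i2 \<sigma> by auto
    show "AE y in lborel. 0 \<le> ?B y" using \<nu> by auto
    show "ennreal (\<integral>y. ?B y \<partial>lborel) = ennreal (\<nu> * ((\<sigma>\<^sup>2 + (t - m)\<^sup>2) / (2 * \<sigma>\<^sup>2) + 1))"
      unfolding sq using i1 i2 \<sigma> by simp
  qed
  finally show ?thesis by (simp add: \<nu>_def)
qed

section \<open>The normalizing constant of the skew-normal density\<close>

text \<open>Matrix determinant lemma for \<open>1 + c u v\<close> with a column \<open>u\<close> and a row \<open>v\<close> of ones: the matrix with
  blocks \<open>1\<close>, \<open>- c u\<close>, \<open>v\<close>, \<open>1\<close> is factored in two ways into block-triangular matrices, one for each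
  Schur complement.\<close>

lemma det_one_plus_const_mat:
  fixes c :: "'a :: idom"
  shows "Determinant.det (1\<^sub>m n + c \<cdot>\<^sub>m Matrix.mat n n (\<lambda>_. 1)) = 1 + of_nat n * c"
proof -
  let ?J = "Matrix.mat n n (\<lambda>_. 1 :: 'a)"
  let ?A = "1\<^sub>m n + c \<cdot>\<^sub>m ?J"
  let ?u = "Matrix.mat n 1 (\<lambda>_. - c)"
  let ?v = "Matrix.mat 1 n (\<lambda>_. 1 :: 'a)"
  let ?d = "Matrix.mat 1 1 (\<lambda>_. 1 + of_nat n * c)"
  let ?I = "1\<^sub>m n :: 'a Matrix.mat" and ?i = "1\<^sub>m 1 :: 'a Matrix.mat"
  let ?L = "four_block_mat ?I (0\<^sub>m n 1) ?v ?i"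
  let ?U = "four_block_mat ?A ?u (0\<^sub>m 1 n) ?i"
  let ?W = "four_block_mat ?I ?u (0\<^sub>m 1 n) ?d"
  have carr: "?L \<in> carrier_mat (n + 1) (n + 1)" "?U \<in> carrier_mat (n + 1) (n + 1)"
    "?W \<in> carrier_mat (n + 1) (n + 1)"
    by (intro four_block_carrier_mat; auto)+
  have "?U * ?L = four_block_mat ?I ?u ?v ?i"
    by (subst mult_four_block_mat[of _ n n _ 1 _ 1 _ _ n _ 1])
      (auto intro!: cong_four_block_mat eq_matI simp: scalar_prod_def)
  moreover have "?L * ?W = four_block_mat ?I ?u ?v ?i"
    by (subst mult_four_block_mat[of _ n n _ 1 _ 1 _ _ n _ 1])
      (auto intro!: cong_four_block_mat eq_matI simp: scalar_prod_def)
  ultimately have "Determinant.det ?U * Determinant.det ?L = Determinant.det ?L * Determinant.det ?W"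
    using det_mult[OF carr(2,1)] det_mult[OF carr(1,3)] by simp
  moreover have "Determinant.det ?L = 1"
    by (subst det_four_block_mat_upper_right_zero[of _ n _ 1]) auto
  moreover have "Determinant.det ?U = Determinant.det ?A"
    by (subst det_four_block_mat_lower_left_zero[of _ n _ 1]) auto
  moreover have "Determinant.det ?W = 1 + of_nat n * c"
    by (subst det_four_block_mat_lower_left_zero[of _ n _ 1]) (auto simp: det_single)
  ultimately show ?thesis by simp
qed

lemma equicorr_mat_carrier: "equicorr_mat n \<rho> \<in> carrier_mat n n"
  by (auto simp: equicorr_mat_def)

lemma det_equicorr_mat:
  "Determinant.det (equicorr_mat n (a\<^sup>2 / (1 + a\<^sup>2))) = (1 + real n * a\<^sup>2) / (1 + a\<^sup>2) ^ n"
proof -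
  have s: "1 + a\<^sup>2 > 0" by (simp add: add_pos_nonneg)
  have \<rho>: "1 - a\<^sup>2 / (1 + a\<^sup>2) = 1 / (1 + a\<^sup>2)" using s by (simp add: field_simps)
  have "equicorr_mat n (a\<^sup>2 / (1 + a\<^sup>2)) =
      (1 / (1 + a\<^sup>2)) \<cdot>\<^sub>m (1\<^sub>m n + a\<^sup>2 \<cdot>\<^sub>m Matrix.mat n n (\<lambda>_. 1))"
    unfolding equicorr_mat_def \<rho> by (rule eq_matI) (auto simp: field_simps)
  then show ?thesis
    by (simp add: det_smult det_one_plus_const_mat power_one_over)
qed

lemma mat_inverse_mult_vec_eq:
  fixes A :: "'a :: field Matrix.mat"
  assumes A: "A \<in> carrier_mat n n" and det: "Determinant.det A \<noteq> 0"
    and w: "w \<in> carrier_vec n" "A *\<^sub>v w = x"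
  shows "the (mat_inverse A) *\<^sub>v x = w"
proof (cases "mat_inverse A")
  case None
  then show ?thesis using mat_inverse(1)[OF A, where b = "()"] det_non_zero_imp_unit[OF A det, where b = "()"] by blast
next
  case (Some B)
  then have "B * A = 1\<^sub>m n" and B: "B \<in> carrier_mat n n" using mat_inverse(2)[OF A] by auto
  then have "B *\<^sub>v (A *\<^sub>v w) = w"
    using w(1) by (simp add: assoc_mult_mat_vec[OF B A w(1), symmetric])
  then show ?thesis using Some w(2) by simp
qed

text \<open>To evaluate the quadratic form of the inverse at \<open>z\<close> it suffices to exhibit one vector \<open>w\<close> that the
  correlation matrix maps to \<open>z\<close>; the one used is given by the Sherman-Morrison formula.\<close>

lemma mvn_density_equicorr_mat:
  fixes a :: real and z :: "nat \<Rightarrow> real"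
  shows "mvn_density n (equicorr_mat n (a\<^sup>2 / (1 + a\<^sup>2))) z =
    exp (- (1/2) * (1 + a\<^sup>2) *
      ((\<Sum>i<n. (z i)\<^sup>2) - a\<^sup>2 / (1 + real n * a\<^sup>2) * (\<Sum>i<n. z i)\<^sup>2))
    / sqrt ((2 * pi) ^ n * ((1 + real n * a\<^sup>2) / (1 + a\<^sup>2) ^ n))"
proof -
  define S where "S = (\<Sum>i<n. z i)"
  define k where "k = a\<^sup>2 / (1 + real n * a\<^sup>2)"
  \<comment> \<open>The inverse of the correlation matrix, applied to \<open>z\<close>.\<close>
  define w where "w i = (1 + a\<^sup>2) * (z i - k * S)" for i
  let ?\<Lambda> = "equicorr_mat n (a\<^sup>2 / (1 + a\<^sup>2))"
  have s: "1 + a\<^sup>2 > 0" "1 + real n * a\<^sup>2 > 0" by (auto intro!: add_pos_nonneg)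
  have sum_w: "(\<Sum>j<n. w j) = (1 + a\<^sup>2) * (S - real n * (k * S))"
    by (simp add: w_def sum_distrib_left[symmetric] sum_subtractf S_def)
  have S': "a\<^sup>2 * (S - real n * (k * S)) = k * S"
    using s by (simp add: k_def divide_simps) (simp add: algebra_simps)
  have "?\<Lambda> *\<^sub>v Matrix.vec n w = Matrix.vec n z"
  proof (rule eq_vecI)
    fix i assume "i < dim_vec (Matrix.vec n z)"
    then have i: "i < n" by simp
    have "Matrix.vec_index (?\<Lambda> *\<^sub>v Matrix.vec n w) i =
        (\<Sum>j<n. ((1 - a\<^sup>2 / (1 + a\<^sup>2)) * (if i = j then 1 else 0) + a\<^sup>2 / (1 + a\<^sup>2)) * w j)"
      using i by (auto simp: equicorr_mat_def scalar_prod_def atLeast0LessThan intro!: sum.cong)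
    also have "\<dots> = (1 - a\<^sup>2 / (1 + a\<^sup>2)) * w i + a\<^sup>2 / (1 + a\<^sup>2) * (\<Sum>j<n. w j)"
    proof -
      have "(\<Sum>j<n. (p * (if i = j then 1 else 0) + r) * w j) =
          (\<Sum>j<n. (if i = j then p * w j else 0) + r * w j)" for p r :: real
        by (intro sum.cong) (auto simp: distrib_right)
      then show ?thesis using i by (simp add: sum.distrib sum_distrib_left)
    qed
    also have "\<dots> = (z i - k * S) + a\<^sup>2 * (S - real n * (k * S))"
      using s unfolding sum_w by (simp add: w_def divide_simps)
    also have "\<dots> = z i" unfolding S' by simp
    finally show "Matrix.vec_index (?\<Lambda> *\<^sub>v Matrix.vec n w) i = Matrix.vec_index (Matrix.vec n z) i" using i by simp
  qed (use equicorr_mat_carrier in auto)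
  then have inv: "the (mat_inverse ?\<Lambda>) *\<^sub>v Matrix.vec n z = Matrix.vec n w"
    using s by (intro mat_inverse_mult_vec_eq[OF equicorr_mat_carrier]) (auto simp: det_equicorr_mat)
  have "scalar_prod (Matrix.vec n z) (Matrix.vec n w) =
      (1 + a\<^sup>2) * ((\<Sum>i<n. (z i)\<^sup>2) - k * S\<^sup>2)"
  proof -
    have "scalar_prod (Matrix.vec n z) (Matrix.vec n w) = (\<Sum>i<n. (1 + a\<^sup>2) * ((z i)\<^sup>2 - k * S * z i))"
      by (auto simp: scalar_prod_def w_def atLeast0LessThan power2_eq_square algebra_simps intro!: sum.cong)
    also have "\<dots> = (1 + a\<^sup>2) * ((\<Sum>i<n. (z i)\<^sup>2) - k * S * S)"
      by (simp add: sum_distrib_left[symmetric] sum_subtractf S_def)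
    finally show ?thesis by (simp add: power2_eq_square mult.assoc)
  qed
  then show ?thesis
    unfolding mvn_density_def inv det_equicorr_mat by (simp add: S_def k_def mult.assoc)
qed

text \<open>For independent standard normals \<open>Z_i\<close> and \<open>U\<close>, the variables \<open>(Z_i - a * U) / s\<close> have unit variance
  and pairwise correlation \<open>a\<^sup>2 / s\<^sup>2\<close>, and they are independent given \<open>U\<close>. The left-hand side is their
  joint density, obtained by conditioning on \<open>U\<close>; its integrand is a multiple of a normal density in \<open>u\<close>.\<close>

lemma nn_integral_normal_density_common_factor:
  fixes a :: real and z :: "nat \<Rightarrow> real"
  defines "s \<equiv> sqrt (1 + a\<^sup>2)"
  shows "(\<integral>\<^sup>+u. ennreal (std_normal_density u * (\<Prod>i<n. normal_density (- a * u / s) (1 / s) (z i))) \<partial>lborel)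
    = ennreal (mvn_density n (equicorr_mat n (a\<^sup>2 / (1 + a\<^sup>2))) z)"
proof -
  define S Q where "S = (\<Sum>i<n. z i)" and "Q = (\<Sum>i<n. (z i)\<^sup>2)"
  define T where "T = 1 + real n * a\<^sup>2"
  have s: "s > 0" and s2: "s\<^sup>2 = 1 + a\<^sup>2" by (auto simp: s_def add_pos_nonneg)
  have T: "T > 0" by (auto simp: T_def intro!: add_pos_nonneg)
  \<comment> \<open>Mean of \<open>U\<close> given the coordinates \<open>z\<close>; its conditional variance is \<open>1 / T\<close>.\<close>
  define m where "m = - (s * a * S) / T"
  let ?D = "mvn_density n (equicorr_mat n (a\<^sup>2 / (1 + a\<^sup>2))) z"
  have factor: "normal_density (- a * u / s) (1 / s) x =
      s / sqrt (2 * pi) * exp (- (s * x + a * u)\<^sup>2 / 2)" for u x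
  proof -
    have "(x - - a * u / s) = (s * x + a * u) / s" using s by (simp add: field_simps)
    then show ?thesis using s
      by (simp add: normal_density_def power_divide real_sqrt_divide real_sqrt_mult)
  qed
  have D: "?D = exp (- (1/2) * (s\<^sup>2 * Q - s\<^sup>2 * a\<^sup>2 * S\<^sup>2 / T)) * (s / sqrt (2 * pi)) ^ n / sqrt T"
  proof -
    have "sqrt ((2 * pi) ^ n * (T / (1 + a\<^sup>2) ^ n)) = sqrt T / (s / sqrt (2 * pi)) ^ n"
      using s by (simp add: real_sqrt_mult real_sqrt_divide real_sqrt_power s_def power_divide power_mult_distrib)
    moreover have "- (1/2) * (1 + a\<^sup>2) * (Q - a\<^sup>2 / T * S\<^sup>2) =
        - (1/2) * (s\<^sup>2 * Q - s\<^sup>2 * a\<^sup>2 * S\<^sup>2 / T)"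
      unfolding s2 by (simp add: right_diff_distrib)
    ultimately show ?thesis
      unfolding mvn_density_equicorr_mat S_def[symmetric] Q_def[symmetric] T_def[symmetric]
      by simp
  qed
  have "std_normal_density u * (\<Prod>i<n. normal_density (- a * u / s) (1 / s) (z i)) =
      ?D * normal_density m (1 / sqrt T) u" for u
  proof -
    have sq: "(\<Sum>i<n. (s * z i + a * u)\<^sup>2) = s\<^sup>2 * Q + 2 * s * a * u * S + real n * a\<^sup>2 * u\<^sup>2"
      by (simp add: S_def Q_def power2_sum power_mult_distrib sum.distrib sum_distrib_left algebra_simps)
    have "(\<Prod>i<n. normal_density (- a * u / s) (1 / s) (z i)) =
        (s / sqrt (2 * pi)) ^ n * exp (- (\<Sum>i<n. (s * z i + a * u)\<^sup>2) / 2)"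
      unfolding factor prod.distrib by (simp add: exp_sum[symmetric] sum_negf sum_divide_distrib)
    moreover have "normal_density m (1 / sqrt T) u = sqrt T / sqrt (2 * pi) * exp (- (T * (u - m)\<^sup>2) / 2)"
      using T by (simp add: normal_density_def power_divide real_sqrt_divide real_sqrt_mult field_simps)
    moreover have "- u\<^sup>2 / 2 + - (\<Sum>i<n. (s * z i + a * u)\<^sup>2) / 2 =
        - (1/2) * (s\<^sup>2 * Q - s\<^sup>2 * a\<^sup>2 * S\<^sup>2 / T) + - (T * (u - m)\<^sup>2) / 2"
    proof -
      have "T * (u - m)\<^sup>2 = T * u\<^sup>2 + 2 * (s * a * S) * u + (s * a * S)\<^sup>2 / T"
        using T by (simp add: m_def power2_eq_square field_simps)
      then show ?thesis unfolding sq
        by (simp add: T_def[symmetric] power_mult_distrib) (simp add: T_def field_simps)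
    qed
    then have "exp (- u\<^sup>2 / 2) * exp (- (\<Sum>i<n. (s * z i + a * u)\<^sup>2) / 2) =
        exp (- (1/2) * (s\<^sup>2 * Q - s\<^sup>2 * a\<^sup>2 * S\<^sup>2 / T)) * exp (- (T * (u - m)\<^sup>2) / 2)"
      by (simp only: exp_add[symmetric])
    ultimately show ?thesis unfolding D std_normal_density_def using T
      by (simp add: mult_ac)
  qed
  moreover have "0 \<le> ?D" unfolding D using T s by simp
  moreover have "(\<integral>\<^sup>+u. ennreal (normal_density m (1 / sqrt T) u) \<partial>lborel) = 1"
    using T is_density_normal_density[of "1 / sqrt T" m] by (simp add: is_density_def)
  ultimately show ?thesis by (simp add: ennreal_mult' nn_integral_cmult)
qed

text \<open>The orthant probability that defines the constant is computed by conditioning on the common factor,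
  given which the \<open>n\<close> coordinates are independent and identically distributed.\<close>

lemma SN_const_eq_nn_integral:
  "ennreal (SN_const n \<alpha>0 \<alpha>1) =
    (\<integral>\<^sup>+u. ennreal (std_normal_density u * std_normal_cdf (\<alpha>0 + \<alpha>1 * u) ^ n) \<partial>lborel)"
proof -
  define s where "s = sqrt (1 + \<alpha>1\<^sup>2)"
  have s: "s > 0" by (auto simp: s_def add_pos_nonneg)
  define b where "b = \<alpha>0 / s"
  let ?\<Lambda> = "equicorr_mat n (\<alpha>1\<^sup>2 / (1 + \<alpha>1\<^sup>2))"
  let ?N = "\<lambda>u. normal_density (- \<alpha>1 * u / s) (1 / s)"
  let ?Pi = "\<Pi>\<^sub>M i\<in>{..<n}. (lborel :: real measure)"
  interpret L: product_sigma_finite "\<lambda>_ :: nat. lborel :: real measure" ..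
  interpret F: finite_product_sigma_finite "\<lambda>_ :: nat. lborel :: real measure" "{..<n}"
    by standard auto
  interpret pair_sigma_finite ?Pi "lborel :: real measure" ..
  define A where "A = {z \<in> space ?Pi. \<forall>i<n. z i \<le> b}"
  have A [measurable]: "A \<in> sets ?Pi" unfolding A_def by measurable
  have meas: "(\<lambda>(z, u). ennreal (std_normal_density u) *
      (\<Prod>i<n. ennreal (?N u (z i)) * indicator {..b} (z i))) \<in> borel_measurable (?Pi \<Otimes>\<^sub>M lborel)"
    by measurable
  have mvn_meas: "(\<lambda>z. ennreal (mvn_density n ?\<Lambda> z)) \<in> borel_measurable ?Pi"
    unfolding mvn_density_equicorr_mat by measurable
  have "emeasure (mvn n ?\<Lambda>) A = (\<integral>\<^sup>+z. ennreal (mvn_density n ?\<Lambda> z) * indicator A z \<partial>?Pi)"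
    unfolding mvn_def using mvn_meas by (rule emeasure_density) fact
  also have "\<dots> = (\<integral>\<^sup>+z. \<integral>\<^sup>+u. ennreal (std_normal_density u) *
      (\<Prod>i<n. ennreal (?N u (z i)) * indicator {..b} (z i)) \<partial>lborel \<partial>?Pi)"
  proof (intro nn_integral_cong)
    fix z assume z: "z \<in> space ?Pi"
    have ind: "indicator A z = (\<Prod>i<n. indicator {..b} (z i) :: ennreal)"
    proof (cases "z \<in> A")
      case True
      then show ?thesis by (auto simp: A_def)
    next
      case False
      then obtain i where "i < n" "\<not> z i \<le> b" using z by (auto simp: A_def)
      then show ?thesis using False by (auto intro!: prod_zero[symmetric] bexI[of _ i])
    qed
    show "ennreal (mvn_density n ?\<Lambda> z) * indicator A z = (\<integral>\<^sup>+u. ennreal (std_normal_density u) *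
      (\<Prod>i<n. ennreal (?N u (z i)) * indicator {..b} (z i)) \<partial>lborel)"
      unfolding nn_integral_normal_density_common_factor[where n = n and a = \<alpha>1 and z = z, folded s_def, symmetric] ind
      by (subst nn_integral_multc[symmetric])
        (auto simp: prod.distrib ennreal_mult' prod_ennreal mult.assoc prod_nonneg intro!: nn_integral_cong)
  qed
  also have "\<dots> = (\<integral>\<^sup>+u. \<integral>\<^sup>+z. ennreal (std_normal_density u) *
      (\<Prod>i<n. ennreal (?N u (z i)) * indicator {..b} (z i)) \<partial>?Pi \<partial>lborel)"
    using Fubini'[OF meas] by simp
  also have "\<dots> = (\<integral>\<^sup>+u. ennreal (std_normal_density u) *
      (\<Prod>i<n. \<integral>\<^sup>+t. ennreal (?N u t) * indicator {..b} t \<partial>lborel) \<partial>lborel)"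
    by (intro nn_integral_cong, subst nn_integral_cmult, measurable)
      (subst L.product_nn_integral_prod[of _ "\<lambda>_ t. ennreal (?N _ t) * indicator {..b} t"]; simp)
  also have "\<dots> = (\<integral>\<^sup>+u. ennreal (std_normal_density u * std_normal_cdf (\<alpha>0 + \<alpha>1 * u) ^ n) \<partial>lborel)"
  proof (intro nn_integral_cong)
    fix u
    have "(b - - \<alpha>1 * u / s) / (1 / s) = \<alpha>0 + \<alpha>1 * u" using s by (simp add: b_def field_simps)
    then show "ennreal (std_normal_density u) *
        (\<Prod>i<n. \<integral>\<^sup>+t. ennreal (?N u t) * indicator {..b} t \<partial>lborel) =
        ennreal (std_normal_density u * std_normal_cdf (\<alpha>0 + \<alpha>1 * u) ^ n)"
      using s std_normal_cdf_pos[of "\<alpha>0 + \<alpha>1 * u"]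
      by (simp add: nn_integral_normal_density_atMost ennreal_mult' ennreal_power)
  qed
  finally have em: "emeasure (mvn n ?\<Lambda>) A =
      (\<integral>\<^sup>+u. ennreal (std_normal_density u * std_normal_cdf (\<alpha>0 + \<alpha>1 * u) ^ n) \<partial>lborel)" .
  also have "\<dots> \<le> (\<integral>\<^sup>+u. ennreal (std_normal_density u) \<partial>lborel)"
    using std_normal_cdf_pos std_normal_cdf_le_1
    by (intro nn_integral_mono ennreal_leI mult_left_le power_le_one) (auto simp: less_imp_le)
  also have "\<dots> = 1" using is_density_normal_density[of 1 0] by (simp add: is_density_def)
  finally have "emeasure (mvn n ?\<Lambda>) A \<noteq> \<top>" by (auto simp: top_unique)
  then have "ennreal (measure (mvn n ?\<Lambda>) A) = emeasure (mvn n ?\<Lambda>) A"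
    by (simp add: emeasure_eq_ennreal_measure)
  moreover have "SN_const n \<alpha>0 \<alpha>1 = measure (mvn n ?\<Lambda>) A"
    unfolding SN_const_def equicorr_normal_cdf_def A_def b_def s_def by (simp add: mvn_def)
  ultimately show ?thesis using em by simp
qed

lemma SN_const_pos: "0 < SN_const n \<alpha>0 \<alpha>1"
proof -
  have "ennreal (SN_const n \<alpha>0 \<alpha>1) \<noteq> 0"
  proof
    assume "ennreal (SN_const n \<alpha>0 \<alpha>1) = 0"
    then have "AE u in lborel.
        ennreal (std_normal_density u * std_normal_cdf (\<alpha>0 + \<alpha>1 * u) ^ n) = 0"
      unfolding SN_const_eq_nn_integral by (subst (asm) nn_integral_0_iff_AE) auto
    moreover have "ennreal (std_normal_density u * std_normal_cdf (\<alpha>0 + \<alpha>1 * u) ^ n) \<noteq> 0" for u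
      by (simp add: normal_density_pos std_normal_cdf_pos ennreal_eq_0_iff not_le)
    ultimately have "AE u in (lborel :: real measure). False" by simp
    then show False
      using AE_iff_measurable[of UNIV "lborel :: real measure" "\<lambda>_. False"] by simp
  qed
  then show ?thesis by (metis ennreal_neg not_less)
qed

lemma SN_density_eq:
  "0 < \<tau> \<Longrightarrow> SN_density n \<alpha>0 \<alpha>1 \<xi> \<tau> t =
    1 / SN_const n \<alpha>0 \<alpha>1 * normal_density \<xi> \<tau> t * std_normal_cdf (\<alpha>0 + \<alpha>1 * ((t - \<xi>) / \<tau>)) ^ n"
  by (simp add: SN_density_def normal_density_affine_std[of \<tau>])

lemma SN_density_pos: "0 < \<tau> \<Longrightarrow> 0 < SN_density n \<alpha>0 \<alpha>1 \<xi> \<tau> t"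
  by (simp add: SN_density_eq SN_const_pos normal_density_pos std_normal_cdf_pos)

lemma is_density_SN_density:
  assumes "0 < \<tau>"
  shows "is_density (SN_density n \<alpha>0 \<alpha>1 \<xi> \<tau>)"
proof -
  let ?K = "SN_const n \<alpha>0 \<alpha>1"
  have [measurable]: "SN_density n \<alpha>0 \<alpha>1 \<xi> \<tau> \<in> borel_measurable borel"
    unfolding SN_density_def[abs_def] by measurable
  have "(\<integral>\<^sup>+t. ennreal (SN_density n \<alpha>0 \<alpha>1 \<xi> \<tau> t) \<partial>lborel) =
      ennreal \<bar>\<tau>\<bar> * (\<integral>\<^sup>+u. ennreal (SN_density n \<alpha>0 \<alpha>1 \<xi> \<tau> (\<xi> + \<tau> * u)) \<partial>lborel)"
    using assms by (intro nn_integral_real_affine) auto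
  also have "\<dots> = (\<integral>\<^sup>+u. ennreal (1 / ?K) *
      ennreal (std_normal_density u * std_normal_cdf (\<alpha>0 + \<alpha>1 * u) ^ n) \<partial>lborel)"
  proof -
    have "\<bar>\<tau>\<bar> * SN_density n \<alpha>0 \<alpha>1 \<xi> \<tau> (\<xi> + \<tau> * u) =
        1 / ?K * (std_normal_density u * std_normal_cdf (\<alpha>0 + \<alpha>1 * u) ^ n)" for u
      using assms by (simp add: SN_density_def)
    then show ?thesis using SN_const_pos[of n \<alpha>0 \<alpha>1]
      by (subst nn_integral_cmult[symmetric]) (auto simp flip: ennreal_mult')
  qed
  also have "\<dots> = ennreal (1 / ?K) * ennreal ?K"
    by (simp add: nn_integral_cmult SN_const_eq_nn_integral)
  also have "\<dots> = 1"
    using SN_const_pos[of n \<alpha>0 \<alpha>1] by (simp flip: ennreal_mult')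
  finally show ?thesis
    using SN_density_pos[OF assms] by (auto simp: is_density_def less_imp_le)
qed

section \<open>The posterior under an order constraint\<close>

text \<open>Integrating out \<open>\<theta>2\<close> over \<open>\<theta>2 \<le> \<theta>1\<close> leaves the factor \<open>\<Phi> ((\<theta>1 - x2) / \<sigma>2)\<close>.\<close>

lemma nn_integral_half_plane_fst:
  assumes "0 < \<sigma>1" "0 < \<sigma>2" and [measurable]: "g \<in> borel_measurable borel"
  shows "(\<integral>\<^sup>+\<theta>. ennreal (likelihood \<sigma>1 \<sigma>2 \<theta> (x1, x2) * uniform_prior {0..} \<theta>) * g (fst \<theta>) \<partial>lborel) =
    (\<integral>\<^sup>+t. ennreal (normal_density x1 \<sigma>1 t * std_normal_cdf ((t - x2) / \<sigma>2)) * g t \<partial>lborel)"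
proof -
  have "(\<integral>\<^sup>+\<theta>. ennreal (likelihood \<sigma>1 \<sigma>2 \<theta> (x1, x2) * uniform_prior {0..} \<theta>) * g (fst \<theta>) \<partial>lborel) =
      (\<integral>\<^sup>+t. \<integral>\<^sup>+u. ennreal (likelihood \<sigma>1 \<sigma>2 (t, u) (x1, x2) * uniform_prior {0..} (t, u)) * g t
        \<partial>lborel \<partial>lborel)"
    unfolding lborel_prod[symmetric]
    by (subst lborel.nn_integral_fst[symmetric])
      (auto simp: likelihood_def uniform_prior_def)
  also have "\<dots> = (\<integral>\<^sup>+t. \<integral>\<^sup>+u. (ennreal (normal_density x1 \<sigma>1 t) * g t) *
      (ennreal (normal_density x2 \<sigma>2 u) * indicator {..t} u) \<partial>lborel \<partial>lborel)"
    by (intro nn_integral_cong)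
      (auto simp: likelihood_def uniform_prior_def normal_density_commute[of _ \<sigma>1 x1]
        normal_density_commute[of _ \<sigma>2 x2]
        indicator_def ennreal_mult' mult_ac)
  also have "\<dots> = (\<integral>\<^sup>+t. ennreal (normal_density x1 \<sigma>1 t * std_normal_cdf ((t - x2) / \<sigma>2)) * g t \<partial>lborel)"
    using assms
    by (intro nn_integral_cong)
      (simp add: nn_integral_cmult nn_integral_normal_density_atMost, simp add: ennreal_mult' mult_ac)
  finally show ?thesis .
qed

lemma nn_integral_posterior_fst:
  assumes "0 < \<sigma>1" "0 < \<sigma>2" and [measurable]: "g \<in> borel_measurable borel"
  shows "(\<integral>\<^sup>+\<theta>. g (fst \<theta>) \<partial>posterior \<sigma>1 \<sigma>2 (uniform_prior {0..}) (x1, x2)) =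
    (\<integral>\<^sup>+t. ennreal (normal_density x1 \<sigma>1 t * std_normal_cdf ((t - x2) / \<sigma>2)) * g t \<partial>lborel)
      / ennreal (std_normal_cdf ((x1 - x2) / sqrt (\<sigma>1\<^sup>2 + \<sigma>2\<^sup>2)))"
proof -
  let ?L = "\<lambda>\<theta>. ennreal (likelihood \<sigma>1 \<sigma>2 \<theta> (x1, x2) * uniform_prior {0..} \<theta>)"
  note [measurable] = borel_measurable_fst_snd
  have [measurable]: "?L \<in> borel_measurable borel"
    by (simp add: likelihood_def uniform_prior_def)
  have Z: "(\<integral>\<^sup>+\<eta>. ?L \<eta> \<partial>lborel) = ennreal (std_normal_cdf ((x1 - x2) / sqrt (\<sigma>1\<^sup>2 + \<sigma>2\<^sup>2)))"
    using nn_integral_half_plane_fst[OF assms(1,2), of "\<lambda>_. 1" x1 x2]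
      nn_integral_normal_density_times_cdf[OF assms(1,2), of x1 x2] by simp
  have "(\<integral>\<^sup>+\<theta>. g (fst \<theta>) \<partial>posterior \<sigma>1 \<sigma>2 (uniform_prior {0..}) (x1, x2)) =
      (\<integral>\<^sup>+\<theta>. ?L \<theta> * g (fst \<theta>) / ennreal (std_normal_cdf ((x1 - x2) / sqrt (\<sigma>1\<^sup>2 + \<sigma>2\<^sup>2))) \<partial>lborel)"
    unfolding posterior_def Z
    by (subst nn_integral_density) (auto simp: ennreal_divide_times ennreal_times_divide)
  also have "\<dots> = (\<integral>\<^sup>+\<theta>. ?L \<theta> * g (fst \<theta>) \<partial>lborel)
      / ennreal (std_normal_cdf ((x1 - x2) / sqrt (\<sigma>1\<^sup>2 + \<sigma>2\<^sup>2)))"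
    by (rule nn_integral_divide) measurable
  finally show ?thesis by (simp only: nn_integral_half_plane_fst[OF assms])
qed

lemma prob_space_posterior_half_plane:
  assumes "0 < \<sigma>1" "0 < \<sigma>2"
  shows "prob_space (posterior \<sigma>1 \<sigma>2 (uniform_prior {0..}) (x1, x2))"
proof
  have "emeasure (posterior \<sigma>1 \<sigma>2 (uniform_prior {0..}) (x1, x2))
      (space (posterior \<sigma>1 \<sigma>2 (uniform_prior {0..}) (x1, x2))) =
      (\<integral>\<^sup>+\<theta>. 1 \<partial>posterior \<sigma>1 \<sigma>2 (uniform_prior {0..}) (x1, x2))" by simp
  also have "\<dots> = 1"
    using nn_integral_posterior_fst[OF assms, of "\<lambda>_. 1" x1 x2]
      nn_integral_normal_density_times_cdf[OF assms, of x1 x2]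
      std_normal_cdf_pos[of "(x1 - x2) / sqrt (\<sigma>1\<^sup>2 + \<sigma>2\<^sup>2)"]
    by (simp add: divide_ennreal)
  finally show "emeasure (posterior \<sigma>1 \<sigma>2 (uniform_prior {0..}) (x1, x2))
      (space (posterior \<sigma>1 \<sigma>2 (uniform_prior {0..}) (x1, x2))) = 1" .
qed

text \<open>The bound \<open>nn_integral_gap_normal_le\<close> is quadratic in \<open>\<theta>1\<close>, and the posterior density of \<open>\<theta>1\<close> is at
  most a multiple of a normal density.\<close>

lemma expected_gap_normal_finite:
  assumes \<alpha>: "-1 \<le> \<alpha>" "\<alpha> < 1" and \<sigma>: "0 < \<sigma>1" "0 < \<sigma>2" "0 < \<sigma>Y"
  shows "(\<integral>\<^sup>+\<theta>. \<integral>\<^sup>+y. divergence_gap \<alpha> (normal_density (fst \<theta>) \<sigma>Y y) (normal_density x1 \<sigma>Y y) \<partial>lborel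
    \<partial>posterior \<sigma>1 \<sigma>2 (uniform_prior {0..}) (x1, x2)) < \<top>"
proof -
  define b where "b t = 2 / (1 - \<alpha>) * ((\<sigma>Y\<^sup>2 + (t - x1)\<^sup>2) / (2 * \<sigma>Y\<^sup>2) + 1)" for t
  have b_nn: "b t \<ge> 0" for t using \<alpha> by (simp add: b_def)
  have [measurable]: "b \<in> borel_measurable borel" unfolding b_def[abs_def] by measurable
  let ?Z = "std_normal_cdf ((x1 - x2) / sqrt (\<sigma>1\<^sup>2 + \<sigma>2\<^sup>2))"
  have "(\<integral>\<^sup>+\<theta>. \<integral>\<^sup>+y. divergence_gap \<alpha> (normal_density (fst \<theta>) \<sigma>Y y) (normal_density x1 \<sigma>Y y) \<partial>lborel
      \<partial>posterior \<sigma>1 \<sigma>2 (uniform_prior {0..}) (x1, x2))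
    \<le> (\<integral>\<^sup>+\<theta>. ennreal (b (fst \<theta>)) \<partial>posterior \<sigma>1 \<sigma>2 (uniform_prior {0..}) (x1, x2))"
    unfolding b_def using nn_integral_gap_normal_le[OF \<alpha> \<sigma>(3)] by (intro nn_integral_mono)
  also have "\<dots> = (\<integral>\<^sup>+t. ennreal (normal_density x1 \<sigma>1 t * std_normal_cdf ((t - x2) / \<sigma>2)) * ennreal (b t)
      \<partial>lborel) / ennreal ?Z"
    using \<sigma> by (intro nn_integral_posterior_fst) auto
  also have "\<dots> \<le> (\<integral>\<^sup>+t. ennreal (normal_density x1 \<sigma>1 t * b t) \<partial>lborel) / ennreal ?Z"
  proof (intro divide_right_mono_ennreal nn_integral_mono)
    fix t
    have "normal_density x1 \<sigma>1 t * std_normal_cdf ((t - x2) / \<sigma>2) * b t \<le> normal_density x1 \<sigma>1 t * b t"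
      using b_nn[of t] by (intro mult_right_mono mult_left_le std_normal_cdf_le_1) auto
    then show "ennreal (normal_density x1 \<sigma>1 t * std_normal_cdf ((t - x2) / \<sigma>2)) * ennreal (b t) \<le>
        ennreal (normal_density x1 \<sigma>1 t * b t)"
      using b_nn[of t] by (simp add: ennreal_mult''[symmetric] ennreal_leI)
  qed
  also have "\<dots> < \<top>"
  proof -
    have split: "normal_density x1 \<sigma>1 t * b t = 2 / (1 - \<alpha>) *
        ((\<sigma>Y\<^sup>2 * normal_density x1 \<sigma>1 t + normal_density x1 \<sigma>1 t * (t - x1)\<^sup>2) / (2 * \<sigma>Y\<^sup>2)
          + normal_density x1 \<sigma>1 t)" for t
      by (simp add: b_def algebra_simps add_divide_distrib)
    have "integrable lborel (\<lambda>t. normal_density x1 \<sigma>1 t * b t)"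
      unfolding split using integrable_normal_moment[OF \<sigma>(1), of x1 2] \<sigma>(1) by auto
    then have "(\<integral>\<^sup>+t. ennreal (normal_density x1 \<sigma>1 t * b t) \<partial>lborel) < \<top>"
      using b_nn by (subst nn_integral_eq_integral) auto
    then show ?thesis using std_normal_cdf_pos[of "(x1 - x2) / sqrt (\<sigma>1\<^sup>2 + \<sigma>2\<^sup>2)"]
      by (simp add: ennreal_divide_eq_top_iff less_top[symmetric])
  qed
  finally show ?thesis .
qed

text \<open>The posterior mean of the \<open>n\<close>-th root is a constant times \<open>N * \<Phi>\<close>, where \<open>N\<close> is a normal density in
  \<open>y\<close> with variance \<open>\<sigma>1\<^sup>2 + n * \<sigma>Y\<^sup>2 = n * \<tau>\<^sup>2\<close> and \<open>\<Phi>\<close> the normal distribution function at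
  \<open>(M - x2) / \<sigma>T\<close>, with \<open>M = x1 + \<beta> * (y - x1)\<close> the mean of \<open>\<theta>1\<close> in the product of the two normal
  densities. The \<open>n\<close>-th root of the skew-normal density is a constant times the same function.\<close>

lemma powr_mean_posterior_half_plane:
  fixes \<sigma>1 \<sigma>2 \<sigma>Y x1 x2 :: real and n :: nat
  assumes \<sigma>: "0 < \<sigma>1" "0 < \<sigma>2" "0 < \<sigma>Y" and n: "0 < n"
    and \<beta>: "\<beta> = \<sigma>1\<^sup>2 / (\<sigma>1\<^sup>2 + real n * \<sigma>Y\<^sup>2)"
    and \<sigma>T: "\<sigma>T = sqrt (\<sigma>2\<^sup>2 + real n * \<beta> * \<sigma>Y\<^sup>2)"
    and \<tau>: "\<tau> = sqrt (\<sigma>1\<^sup>2 / real n + \<sigma>Y\<^sup>2)"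
  shows "\<exists>\<kappa>>0. \<forall>y. (\<integral>\<^sup>+\<theta>. ennreal (normal_density (fst \<theta>) \<sigma>Y y powr (1 / real n))
        \<partial>posterior \<sigma>1 \<sigma>2 (uniform_prior {0..}) (x1, x2)) =
      ennreal (\<kappa> * SN_density n ((x1 - x2) / \<sigma>T) (\<beta> * \<tau> / \<sigma>T) x1 \<tau> y powr (1 / real n))"
proof -
  let ?\<alpha>0 = "(x1 - x2) / \<sigma>T" and ?\<alpha>1 = "\<beta> * \<tau> / \<sigma>T"
  let ?Z = "std_normal_cdf ((x1 - x2) / sqrt (\<sigma>1\<^sup>2 + \<sigma>2\<^sup>2))"
  let ?K = "SN_const n ?\<alpha>0 ?\<alpha>1"
  define a where "a = sqrt (real n) * \<sigma>Y"
  have a: "a > 0" "a\<^sup>2 = real n * \<sigma>Y\<^sup>2" using \<sigma> n by (auto simp: a_def power_mult_distrib)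
  have \<beta>pos: "\<beta> > 0" unfolding \<beta> using \<sigma> by (auto intro!: divide_pos_pos add_pos_nonneg)
  have \<tau>pos: "\<tau> > 0" unfolding \<tau> using \<sigma> by (simp add: add_nonneg_pos)
  have \<sigma>Tpos: "\<sigma>T > 0" unfolding \<sigma>T using \<sigma> \<beta>pos by (simp add: add_pos_nonneg)
  have n\<tau>: "sqrt (real n) * \<tau> = sqrt (\<sigma>1\<^sup>2 + a\<^sup>2)"
    unfolding \<tau> a(2) using n by (simp add: real_sqrt_mult[symmetric] distrib_left)
  have Z: "?Z > 0" and K: "?K > 0" by (auto simp: std_normal_cdf_pos SN_const_pos)
  obtain c where c: "0 < c"
    "\<And>\<mu> y. normal_density \<mu> \<sigma>Y y powr (1 / real n) = c * normal_density \<mu> a y"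
    using normal_density_powr[of \<sigma>Y "real n"] \<sigma> n unfolding a_def by auto
  obtain d where d: "0 < d"
    "\<And>\<mu> y. normal_density \<mu> \<tau> y powr (1 / real n) = d * normal_density \<mu> (sqrt (\<sigma>1\<^sup>2 + a\<^sup>2)) y"
    using normal_density_powr[of \<tau> "real n"] \<tau>pos n unfolding n\<tau> by auto
  define p where "p = (1 / ?K) powr (1 / real n)"
  have p: "p > 0" using K by (simp add: p_def)
  define \<kappa> where "\<kappa> = c / ?Z / (p * d)"
  have "0 < \<kappa>" using c d Z p by (simp add: \<kappa>_def)
  moreover have "(\<integral>\<^sup>+\<theta>. ennreal (normal_density (fst \<theta>) \<sigma>Y y powr (1 / real n))
        \<partial>posterior \<sigma>1 \<sigma>2 (uniform_prior {0..}) (x1, x2)) =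
      ennreal (\<kappa> * SN_density n ?\<alpha>0 ?\<alpha>1 x1 \<tau> y powr (1 / real n))" for y
  proof -
    define M where "M = x1 + \<beta> * (y - x1)"
    \<comment> \<open>\<open>M\<close> and \<open>v\<close> are the conditional mean and standard deviation from \<open>normal_density_mult\<close>.\<close>
    define v where "v = sqrt (a\<^sup>2 * \<beta>)"
    define N where "N = normal_density x1 (sqrt (\<sigma>1\<^sup>2 + a\<^sup>2)) y"
    define \<Phi> where "\<Phi> = std_normal_cdf (?\<alpha>0 + ?\<alpha>1 * ((y - x1) / \<tau>))"
    have N: "N > 0" unfolding N_def using \<sigma> n a(2)
      by (intro normal_density_pos) (simp add: add_pos_nonneg)
    have \<Phi>: "\<Phi> > 0" by (simp add: \<Phi>_def std_normal_cdf_pos)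
    have v: "v > 0" using a(1) \<beta>pos by (simp add: v_def)
    have v2: "v\<^sup>2 = real n * \<sigma>Y\<^sup>2 * \<beta>" using \<beta>pos by (simp add: v_def a(2))
    have sqrt_eq: "sqrt (v\<^sup>2 + \<sigma>2\<^sup>2) = \<sigma>T"
      unfolding v2 \<sigma>T by (simp add: add.commute mult_ac)
    have arg_eq: "(M - x2) / \<sigma>T = ?\<alpha>0 + ?\<alpha>1 * ((y - x1) / \<tau>)"
    proof -
      have "M - x2 = (x1 - x2) + \<beta> * (y - x1)" by (simp add: M_def)
      moreover have "?\<alpha>1 * ((y - x1) / \<tau>) = \<beta> * (y - x1) / \<sigma>T" using \<tau>pos by simp
      ultimately show ?thesis by (simp only: add_divide_distrib)
    qed
    have \<Phi>_eq: "\<Phi> = std_normal_cdf ((M - x2) / sqrt (v\<^sup>2 + \<sigma>2\<^sup>2))"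
      unfolding sqrt_eq arg_eq \<Phi>_def ..
    have prod: "normal_density t a y * normal_density x1 \<sigma>1 t = N * normal_density M v t" for t
      using normal_density_mult[OF a(1) \<sigma>(1), of y t x1]
      unfolding N_def M_def v_def \<beta> a(2)[symmetric]
      by (simp only: normal_density_commute[of t a y])
    have "(\<integral>\<^sup>+\<theta>. ennreal (normal_density (fst \<theta>) \<sigma>Y y powr (1 / real n))
        \<partial>posterior \<sigma>1 \<sigma>2 (uniform_prior {0..}) (x1, x2)) =
      (\<integral>\<^sup>+t. ennreal (normal_density x1 \<sigma>1 t * std_normal_cdf ((t - x2) / \<sigma>2)) *
        ennreal (c * normal_density t a y) \<partial>lborel) / ennreal ?Z"
      unfolding c(2) using \<sigma>
      by (intro nn_integral_posterior_fst[where g = "\<lambda>t. ennreal (c * normal_density t a y)"]) auto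
    also have "(\<integral>\<^sup>+t. ennreal (normal_density x1 \<sigma>1 t * std_normal_cdf ((t - x2) / \<sigma>2)) *
        ennreal (c * normal_density t a y) \<partial>lborel) =
      (\<integral>\<^sup>+t. ennreal (c * N) * ennreal (normal_density M v t * std_normal_cdf ((t - x2) / \<sigma>2)) \<partial>lborel)"
    proof (intro nn_integral_cong)
      fix t
      have "normal_density x1 \<sigma>1 t * std_normal_cdf ((t - x2) / \<sigma>2) * (c * normal_density t a y) =
          c * std_normal_cdf ((t - x2) / \<sigma>2) * (normal_density t a y * normal_density x1 \<sigma>1 t)"
        by (simp add: mult_ac)
      also have "\<dots> = c * N * (normal_density M v t * std_normal_cdf ((t - x2) / \<sigma>2))"
        unfolding prod by (simp add: mult_ac)
      finally have eq: "normal_density x1 \<sigma>1 t * std_normal_cdf ((t - x2) / \<sigma>2) * (c * normal_density t a y) =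
          c * N * (normal_density M v t * std_normal_cdf ((t - x2) / \<sigma>2))" .
      show "ennreal (normal_density x1 \<sigma>1 t * std_normal_cdf ((t - x2) / \<sigma>2)) *
          ennreal (c * normal_density t a y) =
          ennreal (c * N) * ennreal (normal_density M v t * std_normal_cdf ((t - x2) / \<sigma>2))"
        using c(1) N arg_cong[OF eq, of ennreal]
        by (subst (asm) ennreal_mult'', simp, subst (asm) ennreal_mult', simp)
    qed
    also have "\<dots> = ennreal (c * N) * ennreal \<Phi>"
      unfolding \<Phi>_eq nn_integral_normal_density_times_cdf[OF v \<sigma>(2), symmetric]
      by (rule nn_integral_cmult) measurable
    also have "ennreal (c * N) * ennreal \<Phi> / ennreal ?Z = ennreal (c * N * \<Phi> / ?Z)"
      using c(1) N \<Phi> Z by (simp add: divide_ennreal ennreal_mult'[symmetric])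
    also have "c * N * \<Phi> / ?Z = \<kappa> * SN_density n ?\<alpha>0 ?\<alpha>1 x1 \<tau> y powr (1 / real n)"
    proof -
      have "(\<Phi> ^ n) powr (1 / real n) = \<Phi>"
        using \<Phi> n by (simp add: powr_realpow[symmetric] powr_powr)
      moreover have "SN_density n ?\<alpha>0 ?\<alpha>1 x1 \<tau> y powr (1 / real n) =
          (1 / ?K) powr (1 / real n) * normal_density x1 \<tau> y powr (1 / real n) * (\<Phi> ^ n) powr (1 / real n)"
      proof -
        have "(k * g * F) powr e = k powr e * g powr e * F powr e" for k g F e :: real
          by (simp add: powr_mult)
        then show ?thesis unfolding SN_density_eq[OF \<tau>pos] \<Phi>_def .
      qed
      ultimately have "SN_density n ?\<alpha>0 ?\<alpha>1 x1 \<tau> y powr (1 / real n) = p * (d * N) * \<Phi>"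
        by (simp only: d(2) N_def p_def)
      then show ?thesis using d(1) p Z by (simp only: \<kappa>_def) simp
    qed
    finally show ?thesis .
  qed
  ultimately show ?thesis by blast
qed

theorem corollary2p1:
  fixes \<sigma>1 \<sigma>2 \<sigma>Y \<alpha> x1 x2 \<alpha>0 \<alpha>1 \<xi> \<tau> \<sigma>T \<beta> :: real and n :: nat
  assumes "\<sigma>1 > 0" and "\<sigma>2 > 0" and "\<sigma>Y > 0"
    and "-1 \<le> \<alpha>" and "\<alpha> < 1"
    and "n > 0" and "real n = 2 / (1 - \<alpha>)"
    and "\<beta> = \<sigma>1\<^sup>2 / (\<sigma>1\<^sup>2 + real n * \<sigma>Y\<^sup>2)"
    and "\<sigma>T = sqrt (\<sigma>2\<^sup>2 + real n * \<beta> * \<sigma>Y\<^sup>2)"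
    and "\<tau> = sqrt (\<sigma>1\<^sup>2 / real n + \<sigma>Y\<^sup>2)"
    and "\<xi> = x1"
    and "\<alpha>0 = (x1 - x2) / \<sigma>T"
    and "\<alpha>1 = \<beta> * \<tau> / \<sigma>T"
  shows "is_bayes_predictive_density \<alpha> \<sigma>1 \<sigma>2 \<sigma>Y (uniform_prior {0..}) (x1, x2)
           (SN_density n \<alpha>0 \<alpha>1 \<xi> \<tau>)
       \<and> (\<forall>q. is_bayes_predictive_density \<alpha> \<sigma>1 \<sigma>2 \<sigma>Y (uniform_prior {0..}) (x1, x2) q
            \<longrightarrow> (AE y in lborel. q y = SN_density n \<alpha>0 \<alpha>1 \<xi> \<tau> y))"
proof -
  have e: "(1 - \<alpha>) / 2 = 1 / real n" unfolding assms(7) by simp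
  have \<tau>: "\<tau> > 0" unfolding assms(10) using assms(3) by (simp add: add_nonneg_pos)
  have "\<exists>\<kappa>>0. \<forall>y. (\<integral>\<^sup>+\<theta>. ennreal (normal_density (fst \<theta>) \<sigma>Y y powr ((1 - \<alpha>) / 2))
        \<partial>posterior \<sigma>1 \<sigma>2 (uniform_prior {0..}) (x1, x2)) =
      ennreal (\<kappa> * SN_density n \<alpha>0 \<alpha>1 \<xi> \<tau> y powr ((1 - \<alpha>) / 2))"
    unfolding e assms(11-13)
    by (rule powr_mean_posterior_half_plane[OF assms(1-3,6,8-10)])
  then obtain \<kappa> where \<kappa>: "0 < \<kappa>"
    "\<And>y. (\<integral>\<^sup>+\<theta>. ennreal (normal_density (fst \<theta>) \<sigma>Y y powr ((1 - \<alpha>) / 2))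
        \<partial>posterior \<sigma>1 \<sigma>2 (uniform_prior {0..}) (x1, x2)) =
      ennreal (\<kappa> * SN_density n \<alpha>0 \<alpha>1 \<xi> \<tau> y powr ((1 - \<alpha>) / 2))"
    by auto
  note facts = assms(4,5,3) prob_space_posterior_half_plane[OF assms(1,2), of x1 x2]
    is_density_SN_density[OF \<tau>, of n \<alpha>0 \<alpha>1 \<xi>] SN_density_pos[OF \<tau>, of n \<alpha>0 \<alpha>1 \<xi>] \<kappa>
    is_density_normal_density[OF assms(3), of x1] expected_gap_normal_finite[OF assms(4,5,1-3), of x1 x2]
  note bayes = bayes_predictive_density_if_powr_mean[where s = "SN_density n \<alpha>0 \<alpha>1 \<xi> \<tau>" and \<kappa> = \<kappa>
      and r = "normal_density x1 \<sigma>Y"]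
  show ?thesis
  proof (intro conjI allI impI)
    show "is_bayes_predictive_density \<alpha> \<sigma>1 \<sigma>2 \<sigma>Y (uniform_prior {0..}) (x1, x2)
        (SN_density n \<alpha>0 \<alpha>1 \<xi> \<tau>)"
      by (rule bayes(1)) (rule facts)+
    show "AE y in lborel. q y = SN_density n \<alpha>0 \<alpha>1 \<xi> \<tau> y"
      if "is_bayes_predictive_density \<alpha> \<sigma>1 \<sigma>2 \<sigma>Y (uniform_prior {0..}) (x1, x2) q" for q
      by (rule bayes(2)[OF _ _ _ _ _ _ _ _ _ _ that]) (rule facts)+
  qed
qed

end
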